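(* Let $D_1=\mathcal{N}(\boldsymbol\mu_1,\boldsymbol\Sigma_1,S_1)$ and $D_2=\mathcal{N}(\boldsymbol\mu_2,\boldsymbol\Sigma_2,S_2)$ be two truncated Normal distributions on $\mathbb{R}^d$ such that $\mathcal{N}(\boldsymbol\mu_1,\boldsymbol\Sigma_1;S_1)\ge\alpha$ and $\mathcal{N}(\boldsymbol\mu_2,\boldsymbol\Sigma_2;S_2)\ge\alpha$. Then $$d_{\mathrm{TV}}(D_1,D_2)\ \ge\ C_\alpha\, d_{\mathrm{TV}}\big(\mathcal{N}(\boldsymbol\mu_1,\boldsymbol\Sigma_1),\mathcal{N}(\boldsymbol\mu_2,\boldsymbol\Sigma_2)\big),$$ where $C_\alpha<\alpha/8$ is a positive constant that only depends on $\alpha$, and $C_\alpha=\Omega(\alpha^3)$.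
   Context: $\mathcal{N}(\boldsymbol\mu,\boldsymbol\Sigma)$ is the Gaussian with mean $\boldsymbol\mu$ and full rank covariance $\boldsymbol\Sigma$; $\mathcal{N}(\boldsymbol\mu,\boldsymbol\Sigma;S)$ is the mass it assigns to the measurable set $S$; $\mathcal{N}(\boldsymbol\mu,\boldsymbol\Sigma,S)$ is this Gaussian conditioned on lying in $S$. $d_{\mathrm{TV}}$ is total variation distance. *)

theory Defs
  imports
    "HOL-Probability.Probability"
    "HOL-Library.Landau_Symbols"
    "Jordan_Normal_Form.Gauss_Jordan_Elimination"
    "Jordan_Normal_Form.DL_Rank"
begin

(* The dimension must be a term, not a type, so that a constant can be chosen before it.
   Hence points of R^d are extensional functions on {..<d}; the product sigma-algebra is
   the Borel sigma-algebra of R^d. Parameters are d-dimensional vectors and d x d matrices. *)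

abbreviation lborel_dim :: "nat \<Rightarrow> (nat \<Rightarrow> real) measure" where
  "lborel_dim d \<equiv> Pi\<^sub>M {..<d} (\<lambda>_. lborel)"

definition full_rank_covariance :: "nat \<Rightarrow> real mat \<Rightarrow> bool" where
  "full_rank_covariance d \<Sigma> \<longleftrightarrow>
     \<Sigma> \<in> carrier_mat d d \<and> transpose_mat \<Sigma> = \<Sigma> \<and>
     (\<forall>v\<in>carrier_vec d. 0 \<le> scalar_prod v (\<Sigma> *\<^sub>v v)) \<and>
     vec_space.rank d \<Sigma> = d"

(* Meaningful only for a full rank covariance: otherwise the inverse need not exist. *)
definition gaussian_density :: "nat \<Rightarrow> real vec \<Rightarrow> real mat \<Rightarrow> (nat \<Rightarrow> real) \<Rightarrow> real" where
  "gaussian_density d \<mu> \<Sigma> x =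
     (let y = Matrix.vec d x - \<mu> in
      exp (- scalar_prod y (the (mat_inverse \<Sigma>) *\<^sub>v y) / 2)
        / sqrt ((2 * pi) ^ d * Determinant.det \<Sigma>))"

definition gaussian :: "nat \<Rightarrow> real vec \<Rightarrow> real mat \<Rightarrow> (nat \<Rightarrow> real) measure" where
  "gaussian d \<mu> \<Sigma> = density (lborel_dim d) (\<lambda>x. ennreal (gaussian_density d \<mu> \<Sigma> x))"

(* uniform_measure M S is M conditioned on S: it maps A to M (S \<inter> A) / M S. *)
definition truncated_gaussian ::
    "nat \<Rightarrow> real vec \<Rightarrow> real mat \<Rightarrow> (nat \<Rightarrow> real) set \<Rightarrow> (nat \<Rightarrow> real) measure" where
  "truncated_gaussian d \<mu> \<Sigma> S = uniform_measure (gaussian d \<mu> \<Sigma>) S"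

(* For probability measures on the same measurable space. *)
definition tv_dist :: "'a measure \<Rightarrow> 'a measure \<Rightarrow> real" where
  "tv_dist M N = (SUP A\<in>sets M. \<bar>measure M A - measure N A\<bar>)"

end

theory Submission
  imports
    Defs
    "Jordan_Normal_Form.Schur_Decomposition"
    "HOL-Real_Asymp.Real_Asymp"
begin

text \<open>Choose coordinates in which the first Gaussian is standard and the second has a diagonal
  covariance. Under the first Gaussian \<open>P\<close>, the log density ratio is
  \<open>f = k + \<Sum>i. a\<^sub>i y\<^sub>i\<^sup>2 + b\<^sub>i y\<^sub>i\<close> with \<open>y\<^sub>i\<close> independent standard normal; let
  \<open>s\<^sup>2 = \<Sum>i. 2 a\<^sub>i\<^sup>2 + b\<^sub>i\<^sup>2\<close> be its variance. Three dimension-free facts suffice.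

  The \<open>\<chi>\<^sup>2\<close>-divergence is explicit and, for small \<open>s\<close>, bounds the distance of the two Gaussians by
  \<open>O(s)\<close>.

  The characteristic function of \<open>f\<close> is at most \<open>(1 + 2 s\<^sup>2 t\<^sup>2) powr (-1/4)\<close> in modulus, so integrating
  it against a Gaussian kernel gives \<open>P(\<bar>f - c\<bar> \<le> e) = O(sqrt (e / s))\<close> for every \<open>c\<close>.

  If \<open>P(\<bar>f - c\<bar> \<le> e) \<le> P S\<^sub>1 / 2\<close>, then the densities of the conditioned measures differ on half of
  \<open>S\<^sub>1\<close> by a factor of at least \<open>exp e\<close>, whatever \<open>S\<^sub>2\<close> is, so these measures are at distance at least
  \<open>e / 12\<close>. Taking \<open>e\<close> of order \<open>min 1 (\<alpha>\<^sup>2 s)\<close> even gives a constant of order \<open>\<alpha>\<^sup>2\<close>.\<close>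

unbundle no vec_syntax and no inner_syntax

section \<open>Conditioned measures\<close>

text \<open>The sets \<open>S\<^sub>1\<close> and \<open>S\<^sub>2\<close> are arbitrary, so
  conditioning destroys moments and every structural property of the Gaussians. What survives is
  that a set of mass \<alpha> cannot lie mostly where the log density ratio \<open>f\<close> is
  nearly constant. The unknown normalising masses shift the critical value of \<open>f\<close>,
  which is why the band must be small around every centre \<open>c\<close>.

  A square of a single normal variable has a density that blows up like an inverse square root at 0.
  Hence \<open>sqrt (e / s)\<close> is the right order for a small ball and the exponent -1/4 cannot
  be improved; making this at most of order \<alpha> is what costs two powers of \<alpha>.

  One and the same \<open>s\<close> bounds the unconditioned distance from above and the conditioned
  one from below, so it cancels, and with it the dimension and all parameters. The linear algebra
  and the rotation invariance of Lebesgue measure serve to reach coordinates in which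
  \<open>s\<close> can be read off.\<close>

lemma tv_dist_bounds:
  assumes "prob_space M" "prob_space N" "sets M = sets N"
  shows measure_diff_le_tv_dist: "A \<in> sets M \<Longrightarrow> \<bar>measure M A - measure N A\<bar> \<le> tv_dist M N"
    and tv_dist_nonneg: "0 \<le> tv_dist M N"
    and tv_dist_leI: "(\<And>A. A \<in> sets M \<Longrightarrow> \<bar>measure M A - measure N A\<bar> \<le> c) \<Longrightarrow> tv_dist M N \<le> c"
proof -
  interpret M: prob_space M by fact
  interpret N: prob_space N by fact
  have *: "\<bar>measure M A - measure N A\<bar> \<le> 1" for A
    using M.prob_le_1[of A] N.prob_le_1[of A] measure_nonneg[of M A] measure_nonneg[of N A] by linarith
  have bdd: "bdd_above ((\<lambda>A. \<bar>measure M A - measure N A\<bar>) ` sets M)"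
    by (rule bdd_aboveI[of _ 1]) (use * in auto)
  show **: "\<bar>measure M A - measure N A\<bar> \<le> tv_dist M N" if "A \<in> sets M" for A
    unfolding tv_dist_def using bdd that by (rule cSUP_upper2) auto
  show "0 \<le> tv_dist M N"
    using **[of "{}"] by simp
  show "tv_dist M N \<le> c" if "\<And>A. A \<in> sets M \<Longrightarrow> \<bar>measure M A - measure N A\<bar> \<le> c" for c
    unfolding tv_dist_def using that by (intro cSUP_least) auto
qed

lemma tv_dist_le_1:
  assumes "prob_space M" "prob_space N" "sets M = sets N"
  shows "tv_dist M N \<le> 1"
proof (rule tv_dist_leI[OF assms])
  interpret M: prob_space M by fact
  interpret N: prob_space N by fact
  show "\<bar>measure M A - measure N A\<bar> \<le> 1" for A
    using M.prob_le_1[of A] N.prob_le_1[of A] measure_nonneg[of M A] measure_nonneg[of N A] by linarith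
qed

lemma measure_uniform_measure_eq:
  assumes "finite_measure M" "A \<in> sets M" "B \<in> sets M" "measure M A \<noteq> 0"
  shows "measure (uniform_measure M A) B = measure M (A \<inter> B) / measure M A"
  using assms by (intro measure_uniform_measure) (auto simp: measure_def)

lemma exp_density_bounds:
  fixes f :: "'a \<Rightarrow> real" and c :: real
  assumes P: "prob_space P" and Q: "prob_space Q"
    and dens: "Q = density P (\<lambda>x. ennreal (exp (f x)))" and f[measurable]: "f \<in> borel_measurable P"
    and A: "A \<in> sets P"
  shows measure_exp_density_le: "(\<And>x. x \<in> A \<Longrightarrow> f x \<le> c) \<Longrightarrow> measure Q A \<le> exp c * measure P A"
    and measure_exp_density_ge: "(\<And>x. x \<in> A \<Longrightarrow> c \<le> f x) \<Longrightarrow> exp c * measure P A \<le> measure Q A"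
proof -
  interpret P: prob_space P by fact
  interpret Q: prob_space Q by fact
  have e: "emeasure Q A = (\<integral>\<^sup>+x. ennreal (exp (f x)) * indicator A x \<partial>P)"
    unfolding dens using A by (intro emeasure_density) auto
  have c: "(\<integral>\<^sup>+x. ennreal (exp c) * indicator A x \<partial>P) = ennreal (exp c * measure P A)"
    using A by (simp add: nn_integral_cmult_indicator P.emeasure_eq_measure ennreal_mult)
  show "measure Q A \<le> exp c * measure P A" if "\<And>x. x \<in> A \<Longrightarrow> f x \<le> c"
  proof -
    have "emeasure Q A \<le> (\<integral>\<^sup>+x. ennreal (exp c) * indicator A x \<partial>P)"
      unfolding e using that by (intro nn_integral_mono) (auto simp: indicator_def)
    then show ?thesis by (simp add: c Q.emeasure_eq_measure)
  qed
  show "exp c * measure P A \<le> measure Q A" if "\<And>x. x \<in> A \<Longrightarrow> c \<le> f x"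
  proof -
    have "(\<integral>\<^sup>+x. ennreal (exp c) * indicator A x \<partial>P) \<le> emeasure Q A"
      unfolding e using that by (intro nn_integral_mono) (auto simp: indicator_def)
    then show ?thesis by (simp add: c Q.emeasure_eq_measure)
  qed
qed

text \<open>With respect to \<open>P\<close> the conditioned measures have densities
  \<open>1 / p\<close> on \<open>S\<close> and \<open>exp f / q\<close> on \<open>T\<close>. Outside
  a band around the value of \<open>f\<close> where these agree, at least half of the mass of
  \<open>S\<close> splits into three pieces. On each of them the two measures differ by at least
  \<open>e / 2\<close> times the first one's mass. Each gap is at most the distance, so
  \<open>e / 4\<close> is at most three times the distance.\<close>

lemma tv_dist_conditioned_ge:
  fixes f :: "'a \<Rightarrow> real"
  assumes P: "prob_space P" and Q: "prob_space Q"
    and dens: "Q = density P (\<lambda>x. ennreal (exp (f x)))" and f[measurable]: "f \<in> borel_measurable P"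
    and S[measurable]: "S \<in> sets P" and T[measurable]: "T \<in> sets P"
    and pos: "0 < measure P S" "0 < measure Q T"
    and e: "0 < e" "e \<le> 1"
    and small: "\<And>c. measure P {x \<in> space P. \<bar>f x - c\<bar> \<le> e} \<le> measure P S / 2"
  shows "e / 12 \<le> tv_dist (uniform_measure P S) (uniform_measure Q T)"
proof -
  interpret P: prob_space P by fact
  interpret Q: prob_space Q by fact
  let ?D1 = "uniform_measure P S" and ?D2 = "uniform_measure Q T"
  let ?tv = "tv_dist ?D1 ?D2"
  define p where "p = measure P S"
  define q where "q = measure Q T"
  have pq: "0 < p" "0 < q" using pos by (auto simp: p_def q_def)
  have sQ[measurable_cong, simp]: "sets Q = sets P" by (simp add: dens)
  have D: "prob_space ?D1" "prob_space ?D2" "sets ?D1 = sets ?D2"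
    using pos by (auto intro!: prob_space_uniform_measure simp: P.emeasure_eq_measure Q.emeasure_eq_measure)
  have D1: "measure ?D1 A = measure P A / p" if "A \<in> sets P" "A \<subseteq> S" for A
    using that pos by (subst measure_uniform_measure_eq)
      (auto simp: p_def Int_absorb1 P.finite_measure_axioms)
  have D2: "measure ?D2 A = measure Q (T \<inter> A) / q" if "A \<in> sets P" for A
    using that pos by (subst measure_uniform_measure_eq) (auto simp: q_def Q.finite_measure_axioms)
  have tv: "\<bar>measure ?D1 A - measure ?D2 A\<bar> \<le> ?tv" if "A \<in> sets P" for A
    using measure_diff_le_tv_dist[OF D, of A] that by simp
  \<comment> \<open>On \<open>S \<inter> T\<close> the two conditioned densities agree exactly where
    \<open>f = c\<close>.\<close>
  define c where "c = ln (q / p)"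
  have expc: "exp c = q / p" using pq by (simp add: c_def)
  \<comment> \<open>Below the band the second density is at most \<open>exp (- e)\<close> times the
    first, inside and outside \<open>T\<close>. Above the band it is larger on \<open>T\<close> but
    zero off \<open>T\<close>, so \<open>U\<close> and \<open>V\<close> are kept apart: their
    differences have opposite signs and could cancel.\<close>
  define L where "L = {x \<in> S. f x < c - e}"
  define U where "U = {x \<in> S \<inter> T. c + e < f x}"
  define V where "V = {x \<in> S - T. c + e < f x}"
  have L[measurable]: "L \<in> sets P" and U[measurable]: "U \<in> sets P" and V[measurable]: "V \<in> sets P"
  proof -
    have "L = S \<inter> {x \<in> space P. f x < c - e}" "U = S \<inter> T \<inter> {x \<in> space P. c + e < f x}"
      "V = (S - T) \<inter> {x \<in> space P. c + e < f x}"
      using sets.sets_into_space[OF S] by (auto simp: L_def U_def V_def)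
    then show "L \<in> sets P" "U \<in> sets P" "V \<in> sets P" by (simp_all, measurable)
  qed
  \<comment> \<open>This inequality needs \<open>e \<le> 1\<close>: multiplied out,
    \<open>1 / (1 + e) \<le> 1 - e / 2\<close> says \<open>e * e \<le> e\<close>.\<close>
  have e2: "e / 2 \<le> 1 - exp (- e)"
  proof -
    have "exp (- e) * (1 + e) \<le> exp (- e) * exp e"
      by (intro mult_left_mono) (auto simp: exp_ge_add_one_self)
    then have "exp (- e) \<le> 1 / (1 + e)" using e by (simp add: field_simps exp_minus)
    also have "\<dots> \<le> 1 - e / 2" using e by (simp add: field_simps power2_eq_square mult_left_le)
    finally show ?thesis by simp
  qed
  have bL: "e / 2 * (measure P L / p) \<le> ?tv"
  proof -
    have "measure Q (T \<inter> L) \<le> exp (c - e) * measure P (T \<inter> L)"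
      by (rule measure_exp_density_le[OF P Q dens f]) (auto simp: L_def)
    also have "\<dots> \<le> exp (c - e) * measure P L"
      by (intro mult_left_mono P.finite_measure_mono) auto
    finally have "measure Q (T \<inter> L) / q \<le> exp (- e) * (measure P L / p)"
      using pq expc by (simp add: exp_diff exp_minus field_simps)
    moreover have "e / 2 * (measure P L / p) \<le> (1 - exp (- e)) * (measure P L / p)"
      using e2 pq by (intro mult_right_mono) auto
    moreover have "measure ?D1 L = measure P L / p" by (rule D1) (auto simp: L_def)
    ultimately show ?thesis using tv[OF L] D2[OF L] unfolding left_diff_distrib by linarith
  qed
  have bU: "e / 2 * (measure P U / p) \<le> ?tv"
  proof -
    have "exp (c + e) * measure P U \<le> measure Q U"
      by (rule measure_exp_density_ge[OF P Q dens f]) (auto simp: U_def)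
    then have "exp e * (measure P U / p) \<le> measure Q U / q"
      using pq expc by (simp add: exp_add field_simps)
    moreover have "T \<inter> U = U" by (auto simp: U_def)
    moreover have "1 + e / 2 \<le> exp e" using e exp_ge_add_one_self[of e] by linarith
    then have "(1 + e / 2) * (measure P U / p) \<le> exp e * (measure P U / p)"
      using pq by (intro mult_right_mono) auto
    moreover have "measure ?D1 U = measure P U / p" by (rule D1) (auto simp: U_def)
    ultimately show ?thesis using tv[OF U] D2[OF U] by (simp add: algebra_simps)
  qed
  have bV: "e / 2 * (measure P V / p) \<le> ?tv"
  proof -
    have "T \<inter> V = {}" by (auto simp: V_def)
    moreover have "measure ?D1 V = measure P V / p" by (rule D1) (auto simp: V_def)
    ultimately have "measure P V / p \<le> ?tv" using tv[OF V] D2[OF V] pq by simp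
    moreover have "e / 2 * (measure P V / p) \<le> 1 * (measure P V / p)"
      using e pq by (intro mult_right_mono) auto
    ultimately show ?thesis by simp
  qed
  have "p \<le> measure P ({x \<in> space P. \<bar>f x - c\<bar> \<le> e} \<union> (L \<union> (U \<union> V)))"
    unfolding p_def using sets.sets_into_space[OF S]
    by (intro P.finite_measure_mono) (auto simp: L_def U_def V_def abs_le_iff)
  also have "\<dots> \<le> measure P {x \<in> space P. \<bar>f x - c\<bar> \<le> e} + measure P (L \<union> (U \<union> V))"
    by (intro measure_Un_le) auto
  also have "measure P (L \<union> (U \<union> V)) \<le> measure P L + measure P (U \<union> V)"
    by (intro measure_Un_le) auto
  also have "measure P (U \<union> V) \<le> measure P U + measure P V"
    by (intro measure_Un_le) auto
  finally have "p / 2 \<le> measure P L + measure P U + measure P V"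
    using small[of c] by (simp add: p_def)
  then have "1 / 2 \<le> measure P L / p + measure P U / p + measure P V / p"
    using pq by (simp add: field_simps)
  then have "e / 2 * (1 / 2) \<le> e / 2 * (measure P L / p + measure P U / p + measure P V / p)"
    using e by (intro mult_left_mono) auto
  also have "\<dots> \<le> 3 * ?tv" using bL bU bV by (simp add: distrib_left)
  finally show ?thesis by simp
qed

section \<open>Characteristic functions and small balls\<close>

text \<open>Completing the square, so that a Gaussian integral with a linear term reduces to the
  total mass of a normal density.\<close>

lemma exp_quadratic_eq_normal_density:
  fixes k m :: real assumes "0 < k"
  shows "exp (m * x - k * x\<^sup>2 / 2) =
    sqrt (2 * pi / k) * exp (m\<^sup>2 / (2 * k)) * normal_density (m / k) (1 / sqrt k) x"
proof -
  have e: "m * x - k * x\<^sup>2 / 2 = m\<^sup>2 / (2 * k) - (x - m / k)\<^sup>2 / (2 * (1 / k))"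
    using assms by (simp add: field_simps power2_eq_square)
  have "sqrt (2 * pi / k) * (1 / sqrt (2 * pi * (1 / sqrt k)\<^sup>2)) = 1"
    using assms by (simp add: power_divide real_sqrt_divide real_sqrt_mult)
  moreover have "exp (m * x - k * x\<^sup>2 / 2) = exp (m\<^sup>2 / (2 * k)) * exp (- (x - m / k)\<^sup>2 / (2 * (1 / sqrt k)\<^sup>2))"
    using assms by (simp only: e exp_add[symmetric]) (simp add: power_divide)
  moreover have "r * E * (s * F) = (r * s) * (E * F)" for r s E F :: real by simp
  ultimately show ?thesis
    unfolding normal_density_def by simp
qed

lemma
  fixes k m :: real assumes k: "0 < k"
  shows integral_exp_quadratic:
      "(\<integral>x. exp (m * x - k * x\<^sup>2 / 2) \<partial>lborel) = sqrt (2 * pi / k) * exp (m\<^sup>2 / (2 * k))"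
    and integrable_exp_quadratic: "integrable lborel (\<lambda>x. exp (m * x - k * x\<^sup>2 / 2))"
  unfolding exp_quadratic_eq_normal_density[OF k]
  using k integral_normal_density[of "1 / sqrt k"] integrable_normal_density[of "1 / sqrt k"]
  by simp_all

lemma iexp_bounded_integrable:
  fixes g h :: "real \<Rightarrow> real"
  assumes "integrable lborel g" "h \<in> borel_measurable borel"
  shows "integrable lborel (\<lambda>x. complex_of_real (g x) * iexp (h x))"
proof (rule Bochner_Integration.integrable_bound[OF assms(1)])
  show "(\<lambda>x. complex_of_real (g x) * iexp (h x)) \<in> borel_measurable lborel"
    using assms borel_measurable_integrable[OF assms(1)] by measurable
qed (auto simp: norm_mult)

lemma char_normal_density:
  fixes \<sigma> t :: real assumes "0 < \<sigma>"
  shows "(\<integral>x. complex_of_real (normal_density 0 \<sigma> x) * iexp (t * x) \<partial>lborel) = exp (- (\<sigma> * t)\<^sup>2 / 2)"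
proof -
  have "(\<integral>x. complex_of_real (normal_density 0 \<sigma> x) * iexp (t * x) \<partial>lborel) =
    \<bar>\<sigma>\<bar> *\<^sub>R (\<integral>x. complex_of_real (normal_density 0 \<sigma> (0 + \<sigma> * x)) * iexp (t * (0 + \<sigma> * x)) \<partial>lborel)"
    using assms by (intro lborel_integral_real_affine) auto
  also have "\<dots> = (\<integral>x. \<sigma> *\<^sub>R (complex_of_real (normal_density 0 \<sigma> (0 + \<sigma> * x)) * iexp (t * (0 + \<sigma> * x))) \<partial>lborel)"
    using assms by simp
  also have "\<dots> = (\<integral>x. std_normal_density x *\<^sub>R iexp ((\<sigma> * t) * x) \<partial>lborel)"
  proof (rule Bochner_Integration.integral_cong)
    fix x
    have "\<sigma> * normal_density 0 \<sigma> (\<sigma> * x) = std_normal_density x"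
      using assms by (simp add: normal_density_def field_simps real_sqrt_mult)
    then have "complex_of_real \<sigma> * complex_of_real (normal_density 0 \<sigma> (\<sigma> * x)) = complex_of_real (std_normal_density x)"
      by (metis of_real_mult)
    then show "\<sigma> *\<^sub>R (complex_of_real (normal_density 0 \<sigma> (0 + \<sigma> * x)) * iexp (t * (0 + \<sigma> * x)))
      = std_normal_density x *\<^sub>R iexp ((\<sigma> * t) * x)"
      by (simp add: scaleR_conv_of_real mult_ac)
  qed simp
  also have "\<dots> = char std_normal_distribution (\<sigma> * t)"
    unfolding char_def by (subst integral_density) auto
  also have "\<dots> = exp (- (\<sigma> * t)\<^sup>2 / 2)"
    by (simp add: char_std_normal_distribution)
  finally show ?thesis .
qed

text \<open>Symmetrisation: \<open>|\<phi>|\<^sup>2\<close> is an integral over pairs \<open>(x, x + h)\<close>. Centering the pair at its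
  midpoint makes the phase bilinear in \<open>x\<close> and \<open>h\<close> and the weight a product of two Gaussian
  densities, so only the real Gaussian characteristic function is needed.\<close>

lemma norm_char_gaussian_quadratic:
  fixes a b :: real
  defines "\<phi> \<equiv> (\<integral>x. complex_of_real (std_normal_density x) * iexp (a * x\<^sup>2 + b * x) \<partial>lborel)"
  shows "(norm \<phi>)\<^sup>2 = exp (- b\<^sup>2 / (1 + 4 * a\<^sup>2)) / sqrt (1 + 4 * a\<^sup>2)"
proof -
  let ?n = std_normal_density
  let ?q = "\<lambda>x. a * x\<^sup>2 + b * x"
  \<comment> \<open>Midpoint and difference of two independent standard normal variables are
    independent with variances \<open>1 / 2\<close> and \<open>2\<close>; \<open>?u\<close> and
    \<open>?w\<close> are their densities.\<close>
  let ?u = "normal_density 0 (1 / sqrt 2)" and ?w = "normal_density 0 (sqrt 2)"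
  define G where "G x h = complex_of_real (?n x * ?n (x + h)) * iexp (?q (x + h) - ?q x)" for x h
  define H where "H x h = complex_of_real (?u x) * (complex_of_real (?w h) * iexp ((2 * a * x + b) * h))" for x h
  have nn: "?n (x - h / 2) * ?n (x + h / 2) = ?u x * ?w h" for x h
  proof -
    have "- (x - h / 2)\<^sup>2 / 2 + - (x + h / 2)\<^sup>2 / 2 = - x\<^sup>2 + - h\<^sup>2 / 4"
      by (simp add: power2_eq_square field_simps)
    then have "exp (- (x - h / 2)\<^sup>2 / 2) * exp (- (x + h / 2)\<^sup>2 / 2) = exp (- x\<^sup>2) * exp (- h\<^sup>2 / 4)"
      by (simp only: exp_add[symmetric])
    then show ?thesis
      by (simp add: normal_density_def power_divide real_sqrt_mult mult_ac)
  qed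
  have GH: "G (x - h / 2) h = H x h" for x h
  proof -
    have x: "x - h / 2 + h = x + h / 2" by simp
    have q: "?q (x + h / 2) - ?q (x - h / 2) = (2 * a * x + b) * h"
      by (simp add: power2_eq_square field_simps)
    show ?thesis
      unfolding G_def H_def x q nn by (simp only: of_real_mult mult.assoc)
  qed
  have Gm: "case_prod G \<in> borel_measurable (lborel \<Otimes>\<^sub>M lborel)"
    unfolding G_def by measurable
  have Hm: "case_prod H \<in> borel_measurable (lborel \<Otimes>\<^sub>M lborel)"
    unfolding H_def by measurable
  have Gi: "integrable lborel (G x)" for x
  proof -
    have "integrable lborel (\<lambda>h. ?n (x + 1 * h))"
      by (intro lborel_integrable_real_affine) auto
    then show ?thesis unfolding G_def
      by (intro iexp_bounded_integrable) auto
  qed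
  have Hi: "integrable lborel (H x)" for x
    unfolding H_def by (intro integrable_mult_right iexp_bounded_integrable) auto
  have shift: "(\<integral>h. ?n (x + h) \<partial>lborel) = 1" for x
    using lborel_integral_real_affine[of 1 ?n x] by simp
  have GI: "integrable (lborel \<Otimes>\<^sub>M lborel) (case_prod G)"
  proof (rule lborel_pair.Fubini_integrable[OF Gm])
    show "integrable lborel (\<lambda>x. \<integral>y. norm (case_prod G (x, y)) \<partial>lborel)"
      by (simp add: G_def norm_mult shift)
  qed (simp add: Gi)
  have HI: "integrable (lborel \<Otimes>\<^sub>M lborel) (case_prod H)"
  proof (rule lborel_pair.Fubini_integrable[OF Hm])
    show "integrable lborel (\<lambda>x. \<integral>y. norm (case_prod H (x, y)) \<partial>lborel)"
      by (simp add: H_def norm_mult)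
  qed (simp add: Hi)
  have "complex_of_real ((norm \<phi>)\<^sup>2) = cnj \<phi> * \<phi>"
    by (simp only: complex_norm_square mult.commute)
  also have "cnj \<phi> = (\<integral>x. complex_of_real (?n x) * iexp (- ?q x) \<partial>lborel)"
    unfolding \<phi>_def by (subst Bochner_Integration.integral_cnj[symmetric]) (simp add: exp_cnj algebra_simps)
  also have "\<dots> * \<phi> = (\<integral>x. complex_of_real (?n x) * iexp (- ?q x) * \<phi> \<partial>lborel)"
    by simp
  also have "\<dots> = (\<integral>x. (\<integral>h. G x h \<partial>lborel) \<partial>lborel)"
  proof (rule Bochner_Integration.integral_cong)
    fix x
    have "\<phi> = (\<integral>h. complex_of_real (?n (x + h)) * iexp (?q (x + h)) \<partial>lborel)"
      unfolding \<phi>_def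
      using lborel_integral_real_affine[of 1 "\<lambda>y. complex_of_real (?n y) * iexp (?q y)" x] by simp
    then have "complex_of_real (?n x) * iexp (- ?q x) * \<phi> =
      (\<integral>h. complex_of_real (?n x) * iexp (- ?q x) * (complex_of_real (?n (x + h)) * iexp (?q (x + h))) \<partial>lborel)"
      by simp
    also have "\<dots> = (\<integral>h. G x h \<partial>lborel)"
    proof (rule Bochner_Integration.integral_cong)
      fix h
      have "iexp (?q (x + h) - ?q x) = iexp (- ?q x) * iexp (?q (x + h))"
        by (simp only: exp_add[symmetric]) (simp add: algebra_simps)
      then show "complex_of_real (?n x) * iexp (- ?q x) * (complex_of_real (?n (x + h)) * iexp (?q (x + h))) = G x h"
        by (simp only: G_def of_real_mult mult_ac)
    qed simp
    finally show "complex_of_real (?n x) * iexp (- ?q x) * \<phi> = (\<integral>h. G x h \<partial>lborel)" .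
  qed simp
  also have "\<dots> = (\<integral>h. (\<integral>x. G x h \<partial>lborel) \<partial>lborel)"
    by (rule lborel_pair.Fubini_integral[OF GI, symmetric])
  \<comment> \<open>Recentring substitutes \<open>x - h / 2\<close> for \<open>x\<close> with
    \<open>h\<close> fixed, so the integral over \<open>x\<close> has to be the inner one here.
    Afterwards the order is exchanged back, because the integral over \<open>h\<close> is the
    explicit one.\<close>
  also have "\<dots> = (\<integral>h. (\<integral>x. H x h \<partial>lborel) \<partial>lborel)"
  proof (rule Bochner_Integration.integral_cong)
    fix h
    have "(\<integral>x. G x h \<partial>lborel) = (\<integral>x. G (- (h / 2) + 1 * x) h \<partial>lborel)"
      using lborel_integral_real_affine[of 1 "\<lambda>x. G x h" "- (h / 2)"] by simp
    then show "(\<integral>x. G x h \<partial>lborel) = (\<integral>x. H x h \<partial>lborel)"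
      by (simp add: GH[symmetric])
  qed simp
  also have "\<dots> = (\<integral>x. (\<integral>h. H x h \<partial>lborel) \<partial>lborel)"
    by (rule lborel_pair.Fubini_integral[OF HI])
  \<comment> \<open>The inner integral is the characteristic function of a centred normal variable
    of variance \<open>2\<close> at the point \<open>2 * a * x + b\<close>; what remains is a real
    Gaussian integral in \<open>x\<close>.\<close>
  also have "\<dots> = (\<integral>x. complex_of_real (?u x * exp (- (2 * a * x + b)\<^sup>2)) \<partial>lborel)"
  proof (rule Bochner_Integration.integral_cong)
    fix x
    show "(\<integral>h. H x h \<partial>lborel) = complex_of_real (?u x * exp (- (2 * a * x + b)\<^sup>2))"
      unfolding H_def
      by (subst integral_mult_right_zero, subst char_normal_density) (simp_all add: power_mult_distrib)
  qed simp
  also have "\<dots> = complex_of_real (\<integral>x. ?u x * exp (- (2 * a * x + b)\<^sup>2) \<partial>lborel)"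
    by (rule integral_complex_of_real)
  finally have "(norm \<phi>)\<^sup>2 = (\<integral>x. ?u x * exp (- (2 * a * x + b)\<^sup>2) \<partial>lborel)"
    using of_real_eq_iff by blast
  also have "\<dots> = (\<integral>x. exp (- b\<^sup>2) / sqrt pi * exp (- (4 * a * b) * x - (2 * (1 + 4 * a\<^sup>2)) * x\<^sup>2 / 2) \<partial>lborel)"
  proof (rule Bochner_Integration.integral_cong)
    fix x
    have "- x\<^sup>2 + - (2 * a * x + b)\<^sup>2 = - b\<^sup>2 + (- (4 * a * b) * x - (2 * (1 + 4 * a\<^sup>2)) * x\<^sup>2 / 2)"
      by (simp add: power2_eq_square field_simps)
    then have "exp (- x\<^sup>2) * exp (- (2 * a * x + b)\<^sup>2) =
      exp (- b\<^sup>2) * exp (- (4 * a * b) * x - (2 * (1 + 4 * a\<^sup>2)) * x\<^sup>2 / 2)"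
      by (simp only: exp_add[symmetric])
    then show "?u x * exp (- (2 * a * x + b)\<^sup>2) =
      exp (- b\<^sup>2) / sqrt pi * exp (- (4 * a * b) * x - (2 * (1 + 4 * a\<^sup>2)) * x\<^sup>2 / 2)"
      by (simp add: normal_density_def power_divide)
  qed simp
  also have "\<dots> = exp (- b\<^sup>2) / sqrt pi * (sqrt (2 * pi / (2 * (1 + 4 * a\<^sup>2))) *
      exp ((- (4 * a * b))\<^sup>2 / (2 * (2 * (1 + 4 * a\<^sup>2)))))"
    by (subst integral_mult_right_zero, subst integral_exp_quadratic) (auto simp: add_pos_nonneg)
  also have "\<dots> = exp (- b\<^sup>2) * exp ((- (4 * a * b))\<^sup>2 / (2 * (2 * (1 + 4 * a\<^sup>2)))) / sqrt (1 + 4 * a\<^sup>2)"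
    by (subst mult_divide_mult_cancel_left) (simp_all add: real_sqrt_divide)
  also have "exp (- b\<^sup>2) * exp ((- (4 * a * b))\<^sup>2 / (2 * (2 * (1 + 4 * a\<^sup>2)))) = exp (- b\<^sup>2 / (1 + 4 * a\<^sup>2))"
  proof -
    have p: "1 + 4 * a\<^sup>2 > 0" by (simp add: add_pos_nonneg)
    have "- b\<^sup>2 + (- (4 * a * b))\<^sup>2 / (2 * (2 * (1 + 4 * a\<^sup>2))) = - b\<^sup>2 / (1 + 4 * a\<^sup>2)"
      using p by (simp add: field_simps power2_eq_square)
    then show ?thesis by (simp only: exp_add[symmetric])
  qed
  finally show ?thesis .
qed

text \<open>The primitive \<open>2 u (1 + 2 r\<^sup>2 u\<^sup>2) powr (-1/4)\<close> of a majorant is smooth at \<open>0\<close>, unlike the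
  primitive of \<open>\<bar>r u\<bar> powr (-1/2)\<close>.\<close>

lemma nn_integral_std_normal_powr_le:
  fixes r :: real assumes r: "0 < r"
  shows "(\<integral>\<^sup>+u. ennreal (std_normal_density u * (1 + 2 * r\<^sup>2 * u\<^sup>2) powr (-1/4)) \<partial>lborel)
    \<le> ennreal (3 * r powr (-1/2))"
proof -
  let ?w = "\<lambda>u. (1 + 2 * r\<^sup>2 * u\<^sup>2) powr (-1/4)"
  \<comment> \<open>The derivative of the primitive. It dominates \<open>?w\<close> because the
    subtracted term is at most \<open>1 + 2 * r\<^sup>2 * u\<^sup>2\<close> times its power -5/4,
    which is \<open>?w\<close> itself.\<close>
  define g where "g u = 2 * ?w u - 2 * r\<^sup>2 * u\<^sup>2 * (1 + 2 * r\<^sup>2 * u\<^sup>2) powr (-5/4)" for u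
  have pos: "0 < 1 + 2 * r\<^sup>2 * u\<^sup>2" for u by (simp add: add_pos_nonneg)
  have gw: "?w u \<le> g u" for u
  proof -
    have "?w u = (1 + 2 * r\<^sup>2 * u\<^sup>2) * (1 + 2 * r\<^sup>2 * u\<^sup>2) powr (-5/4)"
      using pos[of u] powr_add[of "1 + 2 * r\<^sup>2 * u\<^sup>2" 1 "-5/4"] by simp
    moreover have "2 * r\<^sup>2 * u\<^sup>2 * (1 + 2 * r\<^sup>2 * u\<^sup>2) powr (-5/4) \<le>
      (1 + 2 * r\<^sup>2 * u\<^sup>2) * (1 + 2 * r\<^sup>2 * u\<^sup>2) powr (-5/4)"
      by (intro mult_right_mono) auto
    ultimately show ?thesis by (simp add: g_def)
  qed
  have w1: "?w 1 \<le> r powr (-1/2)"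
  proof -
    have "?w 1 \<le> (r\<^sup>2) powr (-1/4)"
      using r by (intro powr_mono2') auto
    also have "\<dots> = r powr (-1/2)"
      using r by (simp add: powr_powr flip: powr_numeral)
    finally show ?thesis .
  qed
  have n: "std_normal_density u \<le> 1 / 2" for u
  proof -
    have "sqrt 4 \<le> sqrt (2 * pi)" using pi_gt3 by (intro real_sqrt_le_mono) linarith
    then have "1 / sqrt (2 * pi) \<le> 1 / 2" by (intro divide_left_mono) auto
    moreover have "1 / sqrt (2 * pi) * exp (- u\<^sup>2 / 2) \<le> 1 / sqrt (2 * pi) * 1"
      by (intro mult_left_mono) auto
    ultimately show ?thesis unfolding std_normal_density_def by linarith
  qed
  \<comment> \<open>Split at distance 1 from the origin. Inside, the normal density is at most
    \<open>1 / 2\<close> and \<open>g\<close> has integral \<open>4 * ?w 1\<close>; outside,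
    \<open>?w\<close> is at most \<open>r powr (-1/2)\<close>. The two parts contribute 2 and 1 to
    the final constant 3.\<close>
  have le: "std_normal_density u * ?w u \<le> 1 / 2 * g u * indicator {-1..1} u + r powr (-1/2) * std_normal_density u" for u
  proof (cases "u \<in> {-1..1}")
    case True
    have "std_normal_density u * ?w u \<le> 1 / 2 * g u"
      using n[of u] gw[of u] by (intro mult_mono) auto
    then show ?thesis using True by (simp add: add_increasing2)
  next
    case False
    then have "1 \<le> u\<^sup>2" using abs_le_square_iff[of 1 u] by auto
    then have "?w u \<le> ?w 1"
      using pos[of 1] mult_left_mono[of 1 "u\<^sup>2" "2 * r\<^sup>2"] by (intro powr_mono2') auto
    then have "?w u \<le> r powr (-1/2)" using w1 by simp
    then have "std_normal_density u * ?w u \<le> std_normal_density u * r powr (-1/2)"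
      by (intro mult_left_mono) auto
    then show ?thesis using False by (simp add: mult.commute)
  qed
  have gnn: "0 \<le> g u" for u using gw[of u] powr_ge_zero order_trans by blast
  have gm[measurable]: "g \<in> borel_measurable borel" unfolding g_def by measurable
  have "(\<integral>\<^sup>+u. ennreal (std_normal_density u * ?w u) \<partial>lborel) \<le>
    (\<integral>\<^sup>+u. ennreal (1 / 2) * (ennreal (g u) * indicator {-1..1} u) + ennreal (r powr (-1/2)) * ennreal (std_normal_density u) \<partial>lborel)"
  proof (intro nn_integral_mono)
    fix u
    have "ennreal (std_normal_density u * ?w u) \<le> ennreal (1 / 2 * g u * indicator {-1..1} u + r powr (-1/2) * std_normal_density u)"
      using le by (rule ennreal_leI)
    also have "\<dots> = ennreal (1 / 2) * (ennreal (g u) * indicator {-1..1} u) + ennreal (r powr (-1/2)) * ennreal (std_normal_density u)"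
      using gnn[of u] ennreal_mult[of "1 / 2" "g u"]
      by (subst ennreal_plus) (auto simp: ennreal_mult indicator_def simp del: ennreal_half)
    finally show "ennreal (std_normal_density u * ?w u) \<le> \<dots>" .
  qed
  also have "\<dots> = ennreal (1 / 2) * (\<integral>\<^sup>+u. ennreal (g u) * indicator {-1..1} u \<partial>lborel)
    + ennreal (r powr (-1/2)) * (\<integral>\<^sup>+u. ennreal (std_normal_density u) \<partial>lborel)"
    by (subst nn_integral_add) (auto simp: nn_integral_cmult simp del: ennreal_half)
  also have "(\<integral>\<^sup>+u. ennreal (std_normal_density u) \<partial>lborel) = 1"
    by (subst nn_integral_eq_integral) auto
  also have "(\<integral>\<^sup>+u. ennreal (g u) * indicator {-1..1} u \<partial>lborel) = ennreal (2 * 1 * ?w 1 - 2 * (-1) * ?w (-1))"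
  proof (rule nn_integral_FTC_Icc[where F = "\<lambda>u. 2 * u * ?w u"])
    fix u :: real
    have "((\<lambda>u. (1 + 2 * r\<^sup>2 * u\<^sup>2) powr (-1/4)) has_real_derivative
      (-1/4) * (1 + 2 * r\<^sup>2 * u\<^sup>2) powr (-1/4 - of_nat 1) * (2 * r\<^sup>2 * (2 * u))) (at u)"
      using pos[of u] by (intro DERIV_fun_powr) (auto intro!: derivative_eq_intros)
    from _ this have "DERIV (\<lambda>u. 2 * u * ?w u) u :> 2 * ?w u + (-1/4) * (1 + 2 * r\<^sup>2 * u\<^sup>2) powr (-1/4 - of_nat 1) * (2 * r\<^sup>2 * (2 * u)) * (2 * u)"
      by (rule DERIV_mult) (auto intro!: derivative_eq_intros)
    then show "DERIV (\<lambda>u. 2 * u * ?w u) u :> g u"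
      by (rule DERIV_cong) (simp add: g_def power2_eq_square)
  qed (auto simp: gnn)
  also have "ennreal (1 / 2) * ennreal (2 * 1 * ?w 1 - 2 * (-1) * ?w (-1)) + ennreal (r powr (-1/2)) * 1
    = ennreal (2 * ?w 1 + r powr (-1/2))"
    by (simp add: ennreal_mult[symmetric] ennreal_plus[symmetric] del: ennreal_half ennreal_plus)
  also have "\<dots> \<le> ennreal (3 * r powr (-1/2))"
    using w1 by (intro ennreal_leI) simp
  finally show ?thesis .
qed

text \<open>Esseen-type smoothing: the indicator of the band is dominated by twice a Gaussian bump
  in \<open>(f - c) / e\<close>, and the bump is the average of
  \<open>iexp (u * ((f - c) / e))\<close> over a standard normal \<open>u\<close>. After the
  expectations are exchanged, \<open>c\<close> enters only through a phase of modulus one, so the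
  bound is uniform in the centre.\<close>

lemma (in prob_space) small_ball_of_char_bound:
  fixes f :: "'a \<Rightarrow> real"
  assumes f[measurable]: "f \<in> borel_measurable M" and s: "0 < s"
    and char: "\<And>t. norm (\<integral>x. iexp (t * f x) \<partial>M) ^ 4 \<le> 1 / (1 + 2 * t\<^sup>2 * s\<^sup>2)"
    and e: "0 < e"
  shows "prob {x \<in> space M. \<bar>f x - c\<bar> \<le> e} \<le> 6 * sqrt (e / s)"
proof -
  let ?N = std_normal_distribution
  interpret N: real_distribution ?N by (rule real_dist_normal_dist)
  interpret MN: pair_prob_space M ?N ..
  \<comment> \<open>Rescaling the frequency to \<open>u / e\<close> leaves \<open>s / e\<close> as
    the only parameter.\<close>
  define r where "r = s / e"
  have r: "0 < r" using s e by (simp add: r_def)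
  define \<phi> where "\<phi> t = (\<integral>x. iexp (t * f x) \<partial>M)" for t
  have \<phi>: "norm (\<phi> (u / e)) \<le> (1 + 2 * r\<^sup>2 * u\<^sup>2) powr (-1/4)" for u
  proof -
    have "norm (\<phi> (u / e)) = (norm (\<phi> (u / e)) ^ 4) powr (1/4)"
      by (simp add: powr_powr flip: powr_realpow' powr_numeral)
    also have "\<dots> \<le> (1 / (1 + 2 * (u / e)\<^sup>2 * s\<^sup>2)) powr (1/4)"
      using char[of "u / e"] by (intro powr_mono2) (auto simp: \<phi>_def)
    also have "\<dots> = (1 + 2 * r\<^sup>2 * u\<^sup>2) powr (-1/4)"
      by (simp add: powr_minus_divide powr_divide r_def power_divide field_simps)
    finally show ?thesis .
  qed
  have kernel: "(\<integral>u. iexp (u * y) \<partial>?N) = exp (- y\<^sup>2 / 2)" for y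
    using fun_cong[OF char_std_normal_distribution, of y] by (simp add: char_def mult.commute)
  \<comment> \<open>On the band the bump is at least \<open>exp (- (1 / 2))\<close>, which exceeds
    \<open>1 / 2\<close>; this factor 2 and the kernel integral's factor 3 give the constant
    6.\<close>
  have "1 \<le> 2 * exp (- ((f x - c) / e)\<^sup>2 / 2)" if "\<bar>f x - c\<bar> \<le> e" for x
  proof -
    have "((f x - c) / e)\<^sup>2 \<le> 1" using that e by (simp add: abs_square_le_1 abs_divide)
    then have "exp (- (1 / 2)) \<le> exp (- ((f x - c) / e)\<^sup>2 / 2)" by simp
    moreover have "1 / 2 \<le> exp (- (1 / 2) :: real)" using exp_ge_add_one_self[of "- (1/2) :: real"] by simp
    ultimately show ?thesis by linarith
  qed
  then have "prob {x \<in> space M. \<bar>f x - c\<bar> \<le> e} \<le> (\<integral>x. 2 * exp (- ((f x - c) / e)\<^sup>2 / 2) \<partial>M)"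
  proof -
    assume *: "\<And>x. \<bar>f x - c\<bar> \<le> e \<Longrightarrow> 1 \<le> 2 * exp (- ((f x - c) / e)\<^sup>2 / 2)"
    have "(\<integral>x. indicator {x \<in> space M. \<bar>f x - c\<bar> \<le> e} x \<partial>M) \<le> (\<integral>x. 2 * exp (- ((f x - c) / e)\<^sup>2 / 2) \<partial>M)"
    proof (rule integral_mono)
      show "integrable M (\<lambda>x. 2 * exp (- ((f x - c) / e)\<^sup>2 / 2))"
        by (intro integrable_const_bound[where B = 2]) auto
      show "integrable M (indicator {x \<in> space M. \<bar>f x - c\<bar> \<le> e} :: _ \<Rightarrow> real)"
        by (intro integrable_const_bound[where B = 1]) (auto simp: indicator_def)
    qed (use * in \<open>auto simp: indicator_def less_top[symmetric]\<close>)
    then show ?thesis by simp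
  qed
  also have "\<dots> = 2 * norm (\<integral>x. complex_of_real (exp (- ((f x - c) / e)\<^sup>2 / 2)) \<partial>M)"
    by simp
  also have "(\<integral>x. complex_of_real (exp (- ((f x - c) / e)\<^sup>2 / 2)) \<partial>M)
    = (\<integral>x. (\<integral>u. iexp (u * ((f x - c) / e)) \<partial>?N) \<partial>M)"
    unfolding kernel by simp
  also have "\<dots> = (\<integral>u. (\<integral>x. iexp (u * ((f x - c) / e)) \<partial>M) \<partial>?N)"
    by (rule MN.Fubini_integral[symmetric], rule MN.integrable_const_bound[where B = 1]) auto
  also have "\<dots> = (\<integral>u. iexp (- u * c / e) * \<phi> (u / e) \<partial>?N)"
  proof (rule Bochner_Integration.integral_cong)
    fix u
    have "iexp (u * ((f x - c) / e)) = iexp (- u * c / e) * iexp (u / e * f x)" for x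
      by (simp add: exp_add[symmetric] diff_divide_distrib algebra_simps)
    then show "(\<integral>x. iexp (u * ((f x - c) / e)) \<partial>M) = iexp (- u * c / e) * \<phi> (u / e)"
      by (simp add: \<phi>_def)
  qed simp
  also have "norm \<dots> \<le> 3 * r powr (-1/2)"
  proof -
    have "ennreal (norm (\<integral>u. iexp (- u * c / e) * \<phi> (u / e) \<partial>?N)) \<le>
      (\<integral>\<^sup>+u. norm (iexp (- u * c / e) * \<phi> (u / e)) \<partial>?N)"
    proof (rule integral_norm_bound_ennreal)
      have [measurable]: "\<phi> \<in> borel_measurable borel" unfolding \<phi>_def by measurable
      have "norm (\<phi> t) \<le> 1" for t
        using integral_norm_bound[of M "\<lambda>x. iexp (t * f x)"] by (simp add: \<phi>_def prob_space)
      then show "integrable ?N (\<lambda>u. iexp (- u * c / e) * \<phi> (u / e))"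
        by (intro N.integrable_const_bound[where B = 1]) (auto simp: norm_mult)
    qed
    also have "\<dots> \<le> (\<integral>\<^sup>+u. ennreal ((1 + 2 * r\<^sup>2 * u\<^sup>2) powr (-1/4)) \<partial>?N)"
      using \<phi> by (intro nn_integral_mono ennreal_leI) (simp add: norm_mult)
    also have "\<dots> = (\<integral>\<^sup>+u. ennreal (std_normal_density u * (1 + 2 * r\<^sup>2 * u\<^sup>2) powr (-1/4)) \<partial>lborel)"
      by (subst nn_integral_density) (auto simp: ennreal_mult)
    also have "\<dots> \<le> ennreal (3 * r powr (-1/2))" by (rule nn_integral_std_normal_powr_le[OF r])
    finally show ?thesis by simp
  qed
  also have "r powr (-1/2) = sqrt (e / s)"
    using s e by (simp add: powr_minus_divide powr_half_sqrt r_def real_sqrt_divide)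
  finally show ?thesis by simp
qed

section \<open>Separable quadratics of independent standard normal variables\<close>

abbreviation std_normal_PiM :: "'i set \<Rightarrow> ('i \<Rightarrow> real) measure" where
  "std_normal_PiM I \<equiv> Pi\<^sub>M I (\<lambda>_. std_normal_distribution)"

definition separable_quadratic :: "'i set \<Rightarrow> real \<Rightarrow> ('i \<Rightarrow> real) \<Rightarrow> ('i \<Rightarrow> real) \<Rightarrow> ('i \<Rightarrow> real) \<Rightarrow> real" where
  "separable_quadratic I k a b y = k + (\<Sum>i\<in>I. a i * (y i)\<^sup>2 + b i * y i)"

lemma measurable_separable_quadratic [measurable]:
  "finite I \<Longrightarrow> separable_quadratic I k a b \<in> borel_measurable (std_normal_PiM I)"
  unfolding separable_quadratic_def by measurable

lemma prod_add_one_ge: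
  fixes x :: "'i \<Rightarrow> real"
  assumes "finite I" "\<And>i. i \<in> I \<Longrightarrow> 0 \<le> x i"
  shows "1 + sum x I \<le> (\<Prod>i\<in>I. 1 + x i)"
  using assms
proof (induction I rule: finite_induct)
  case (insert i I)
  have "1 + sum x (insert i I) \<le> (1 + x i) * (1 + sum x I)"
    using insert by (simp add: algebra_simps sum_nonneg)
  also have "\<dots> \<le> (1 + x i) * (\<Prod>i\<in>I. 1 + x i)"
    using insert by (intro mult_left_mono) auto
  finally show ?case using insert by simp
qed simp

lemma prod_sigma_finite_std_normal: "product_sigma_finite (\<lambda>_. std_normal_distribution)"
proof -
  interpret N: real_distribution std_normal_distribution by (rule real_dist_normal_dist)
  show ?thesis by standard
qed

lemma prob_space_std_normal_PiM: "prob_space (std_normal_PiM I)"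
proof (rule prob_space_PiM)
  interpret N: real_distribution std_normal_distribution by (rule real_dist_normal_dist)
  show "prob_space std_normal_distribution" by unfold_locales
qed

text \<open>Independence factorises the characteristic function, and the fourth power removes the
  roots from the one-dimensional formula. The squares contribute a product, of which only the
  constant and first-order terms are kept; the linear terms contribute an exponential, weakened to a
  reciprocal. In this form the two contributions add up to the variance.\<close>

lemma norm_char_separable_quadratic_le:
  fixes a b :: "'i \<Rightarrow> real"
  assumes I: "finite I"
  shows "norm (\<integral>y. iexp (t * separable_quadratic I k a b y) \<partial>std_normal_PiM I) ^ 4
    \<le> 1 / (1 + 2 * t\<^sup>2 * (\<Sum>i\<in>I. 2 * (a i)\<^sup>2 + (b i)\<^sup>2))"
proof -
  interpret N: real_distribution std_normal_distribution by (rule real_dist_normal_dist)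
  interpret product_sigma_finite "\<lambda>_::'i. std_normal_distribution" by (rule prod_sigma_finite_std_normal)
  let ?N = std_normal_distribution
  let ?x = "\<lambda>i. 4 * (t * a i)\<^sup>2"
  \<comment> \<open>A lower bound for the product of all \<open>1 + ?x i\<close> and an upper bound
    for each of them. It can therefore replace both the product in the denominator and the separate
    denominators in the exponents.\<close>
  define m where "m = 1 + sum ?x I"
  have m: "1 \<le> m" unfolding m_def by (auto intro!: sum_nonneg)
  have char1: "norm (\<integral>u. iexp (t * (a i * u\<^sup>2 + b i * u)) \<partial>?N) ^ 4
    = exp (- 2 * (t * b i)\<^sup>2 / (1 + ?x i)) / (1 + ?x i)" for i
  proof -
    have eq: "(\<integral>u. iexp (t * (a i * u\<^sup>2 + b i * u)) \<partial>?N) =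
      (\<integral>u. complex_of_real (std_normal_density u) * iexp ((t * a i) * u\<^sup>2 + (t * b i) * u) \<partial>lborel)"
      by (subst integral_density) (auto simp: scaleR_conv_of_real algebra_simps)
    have pos: "0 \<le> 1 + ?x i" by simp
    have "norm (\<integral>u. iexp (t * (a i * u\<^sup>2 + b i * u)) \<partial>?N) ^ 4 =
      ((norm (\<integral>u. iexp (t * (a i * u\<^sup>2 + b i * u)) \<partial>?N))\<^sup>2)\<^sup>2" by simp
    also have "\<dots> = (exp (- (t * b i)\<^sup>2 / (1 + ?x i)) / sqrt (1 + ?x i))\<^sup>2"
      unfolding eq norm_char_gaussian_quadratic ..
    also have "\<dots> = exp (- 2 * (t * b i)\<^sup>2 / (1 + ?x i)) / (1 + ?x i)"
      unfolding power_divide real_sqrt_pow2[OF pos]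
      by (simp add: power2_eq_square flip: exp_add)
    finally show ?thesis .
  qed
  have "(\<integral>y. iexp (t * separable_quadratic I k a b y) \<partial>std_normal_PiM I)
    = (\<integral>y. iexp (t * k) * (\<Prod>i\<in>I. iexp (t * (a i * (y i)\<^sup>2 + b i * y i))) \<partial>std_normal_PiM I)"
    by (intro Bochner_Integration.integral_cong)
       (simp_all add: separable_quadratic_def exp_sum[OF I, symmetric] exp_add[symmetric] distrib_left sum_distrib_left)
  also have "\<dots> = iexp (t * k) * (\<Prod>i\<in>I. (\<integral>u. iexp (t * (a i * u\<^sup>2 + b i * u)) \<partial>?N))"
    by (subst integral_mult_right_zero, subst product_integral_prod[OF I])
       (auto intro!: N.integrable_const_bound[where B = 1])
  finally have "norm (\<integral>y. iexp (t * separable_quadratic I k a b y) \<partial>std_normal_PiM I) ^ 4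
    = (\<Prod>i\<in>I. norm (\<integral>u. iexp (t * (a i * u\<^sup>2 + b i * u)) \<partial>?N) ^ 4)"
    by (simp add: norm_mult prod_norm[symmetric] prod_power_distrib)
  also have "\<dots> = (\<Prod>i\<in>I. exp (- 2 * (t * b i)\<^sup>2 / (1 + ?x i))) / (\<Prod>i\<in>I. 1 + ?x i)"
    unfolding char1 by (rule prod_dividef)
  also have "\<dots> \<le> (\<Prod>i\<in>I. exp (- 2 * (t * b i)\<^sup>2 / m)) / m"
  proof (intro frac_le prod_mono conjI prod_nonneg)
    fix i assume i: "i \<in> I"
    have "1 + ?x i \<le> m"
      unfolding m_def using I i member_le_sum[of i I ?x] by auto
    then have "2 * (t * b i)\<^sup>2 / m \<le> 2 * (t * b i)\<^sup>2 / (1 + ?x i)"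
      using m by (intro divide_left_mono mult_pos_pos) (auto simp: add_pos_nonneg)
    then show "exp (- 2 * (t * b i)\<^sup>2 / (1 + ?x i)) \<le> exp (- 2 * (t * b i)\<^sup>2 / m)"
      by simp
  qed (use m prod_add_one_ge[OF I, of ?x] in \<open>auto simp: m_def\<close>)
  also have "(\<Prod>i\<in>I. exp (- 2 * (t * b i)\<^sup>2 / m)) = exp (- (2 * t\<^sup>2 * (\<Sum>i\<in>I. (b i)\<^sup>2) / m))"
    by (simp add: exp_sum[OF I, symmetric] sum_negf sum_distrib_left sum_divide_distrib power_mult_distrib mult.assoc)
  \<comment> \<open>\<open>exp (- z) \<le> 1 / (1 + z)\<close>. As the exponent carries the
    denominator \<open>m\<close>, the product \<open>m * (1 + z)\<close> is \<open>m\<close> plus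
    the sum over the \<open>b i\<close>, without any mixed term.\<close>
  also have "\<dots> / m \<le> 1 / (1 + 2 * t\<^sup>2 * (\<Sum>i\<in>I. (b i)\<^sup>2) / m) / m"
  proof -
    let ?z = "2 * t\<^sup>2 * (\<Sum>i\<in>I. (b i)\<^sup>2) / m"
    have "0 \<le> ?z" using m by (auto intro!: divide_nonneg_nonneg mult_nonneg_nonneg sum_nonneg)
    then have "exp (- ?z) \<le> 1 / (1 + ?z)"
      using exp_ge_add_one_self[of ?z] by (simp add: exp_minus inverse_eq_divide frac_le)
    then show ?thesis using m by (intro divide_right_mono) auto
  qed
  also have "\<dots> = 1 / (m + 2 * t\<^sup>2 * (\<Sum>i\<in>I. (b i)\<^sup>2))"
    using m by (simp only: divide_divide_eq_left distrib_right) simp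
  also have "m + 2 * t\<^sup>2 * (\<Sum>i\<in>I. (b i)\<^sup>2) = 1 + 2 * t\<^sup>2 * (\<Sum>i\<in>I. 2 * (a i)\<^sup>2 + (b i)\<^sup>2)"
    by (simp add: m_def sum.distrib sum_distrib_left distrib_left power_mult_distrib mult.assoc)
  finally show ?thesis .
qed

lemma
  fixes a b :: real
  assumes a: "a < 1 / 2"
  shows std_normal_integral_exp_quadratic:
      "(\<integral>u. exp (a * u\<^sup>2 + b * u) \<partial>std_normal_distribution) = exp (b\<^sup>2 / (2 * (1 - 2 * a))) / sqrt (1 - 2 * a)"
    and std_normal_integrable_exp_quadratic:
      "integrable std_normal_distribution (\<lambda>u. exp (a * u\<^sup>2 + b * u))"
proof -
  have e: "std_normal_density u * exp (a * u\<^sup>2 + b * u) = 1 / sqrt (2 * pi) * exp (b * u - (1 - 2 * a) * u\<^sup>2 / 2)" for u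
  proof -
    have "- u\<^sup>2 / 2 + (a * u\<^sup>2 + b * u) = b * u - (1 - 2 * a) * u\<^sup>2 / 2"
      by (simp add: field_simps)
    then have "exp (- u\<^sup>2 / 2) * exp (a * u\<^sup>2 + b * u) = exp (b * u - (1 - 2 * a) * u\<^sup>2 / 2)"
      by (simp only: exp_add[symmetric])
    then show ?thesis unfolding std_normal_density_def by simp
  qed
  have k: "0 < 1 - 2 * a" using a by simp
  have "(\<integral>u. exp (a * u\<^sup>2 + b * u) \<partial>std_normal_distribution) =
    (\<integral>u. 1 / sqrt (2 * pi) * exp (b * u - (1 - 2 * a) * u\<^sup>2 / 2) \<partial>lborel)"
    by (subst integral_real_density) (auto simp: e)
  also have "\<dots> = 1 / sqrt (2 * pi) * (sqrt (2 * pi / (1 - 2 * a)) * exp (b\<^sup>2 / (2 * (1 - 2 * a))))"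
    by (subst integral_mult_right_zero) (simp only: integral_exp_quadratic[OF k])
  also have "\<dots> = exp (b\<^sup>2 / (2 * (1 - 2 * a))) / sqrt (1 - 2 * a)"
    by (simp add: real_sqrt_divide)
  finally show "(\<integral>u. exp (a * u\<^sup>2 + b * u) \<partial>std_normal_distribution) = exp (b\<^sup>2 / (2 * (1 - 2 * a))) / sqrt (1 - 2 * a)" .
  have "integrable lborel (\<lambda>u. std_normal_density u * exp (a * u\<^sup>2 + b * u))"
    unfolding e using integrable_exp_quadratic[OF k] by (rule integrable_mult_right)
  then show "integrable std_normal_distribution (\<lambda>u. exp (a * u\<^sup>2 + b * u))"
    by (subst integrable_real_density) auto
qed

text \<open>The contribution of one coordinate to the second moment of the density ratio. Measured
  against the squared first moment, it deviates from 1 only to second order in \<open>a\<close> and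
  \<open>b\<close>. The bound on \<open>a\<close> keeps \<open>1 - 4 * a\<close> away from 0, where
  the second moment becomes infinite.\<close>

lemma std_normal_chi_square_factor_le:
  fixes a b :: real
  assumes a: "\<bar>a\<bar> \<le> 1 / 8"
  shows "(\<integral>u. exp (2 * (a * u\<^sup>2 + b * u)) \<partial>std_normal_distribution)
    \<le> exp (6 * a\<^sup>2 + 3 * b\<^sup>2) * (\<integral>u. exp (a * u\<^sup>2 + b * u) \<partial>std_normal_distribution)\<^sup>2"
proof -
  have pos: "1 / 2 \<le> 1 - 4 * a" "3 / 4 \<le> 1 - 2 * a" using a by linarith+
  have "(\<integral>u. exp (2 * (a * u\<^sup>2 + b * u)) \<partial>std_normal_distribution)
    = (\<integral>u. exp ((2 * a) * u\<^sup>2 + (2 * b) * u) \<partial>std_normal_distribution)"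
    by (simp add: algebra_simps)
  also have "\<dots> = exp (2 * b\<^sup>2 / (1 - 4 * a)) / sqrt (1 - 4 * a)"
  proof -
    have "(2 * b)\<^sup>2 / (2 * (1 - 2 * (2 * a))) = 2 * b\<^sup>2 / (1 - 4 * a)"
      using pos by (simp add: field_simps power2_eq_square)
    then show ?thesis using pos by (subst std_normal_integral_exp_quadratic) auto
  qed
  also have "\<dots> \<le> exp (6 * a\<^sup>2 + 3 * b\<^sup>2) * (exp (b\<^sup>2 / (1 - 2 * a)) / (1 - 2 * a))"
  proof -
    have b: "2 * b\<^sup>2 / (1 - 4 * a) \<le> 3 * b\<^sup>2 + b\<^sup>2 / (1 - 2 * a)"
    proof -
      have "1 / 2 * (3 / 4) \<le> (1 - 4 * a) * (1 - 2 * a)"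
        using pos by (intro mult_mono) auto
      then have "1 \<le> 3 * ((1 - 4 * a) * (1 - 2 * a))" by simp
      then have "1 / ((1 - 4 * a) * (1 - 2 * a)) \<le> 3"
        using pos by (simp add: divide_le_eq)
      \<comment> \<open>With \<open>p = 1 - 4 * a\<close> and \<open>q = 1 - 2 * a\<close>, the term
        \<open>1 / q\<close> is the exponent already present in the squared first moment, and
        \<open>1 / (p * q)\<close> is the excess to be bounded by 3.\<close>
      moreover have "2 / p = 1 / (p * q) + 1 / q" if "0 < p" "0 < q" "1 + p = 2 * q" for p q :: real
        using that by (simp add: field_simps)
      from this[of "1 - 4 * a" "1 - 2 * a"]
      have "2 / (1 - 4 * a) = 1 / ((1 - 4 * a) * (1 - 2 * a)) + 1 / (1 - 2 * a)"
        using pos by simp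
      ultimately have "2 / (1 - 4 * a) \<le> 3 + 1 / (1 - 2 * a)" by simp
      then show ?thesis using mult_right_mono[of "2 / (1 - 4 * a)" "3 + 1 / (1 - 2 * a)" "b\<^sup>2"]
        by (simp add: algebra_simps)
    qed
    have "(1 - 2 * a) / sqrt (1 - 4 * a) \<le> exp (6 * a\<^sup>2)"
    proof (rule power2_le_imp_le)
      have "((1 - 2 * a) / sqrt (1 - 4 * a))\<^sup>2 = (1 - 2 * a)\<^sup>2 / (1 - 4 * a)"
        using pos by (simp add: power_divide)
      also have "\<dots> = 1 + 4 * a\<^sup>2 / (1 - 4 * a)"
        using pos by (simp add: field_simps power2_eq_square)
      also have "4 * a\<^sup>2 / (1 - 4 * a) \<le> 4 * a\<^sup>2 / (1 / 2)"
        using pos by (intro divide_left_mono) auto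
      also have "1 + 4 * a\<^sup>2 / (1 / 2) \<le> 1 + 2 * (6 * a\<^sup>2)" by simp
      also have "\<dots> \<le> exp (2 * (6 * a\<^sup>2))" by (rule exp_ge_add_one_self)
      also have "\<dots> = (exp (6 * a\<^sup>2))\<^sup>2" by (rule exp_double)
      finally show "((1 - 2 * a) / sqrt (1 - 4 * a))\<^sup>2 \<le> (exp (6 * a\<^sup>2))\<^sup>2" by simp
    qed simp
    then have "1 / sqrt (1 - 4 * a) \<le> exp (6 * a\<^sup>2) / (1 - 2 * a)"
      using pos by (simp add: field_simps)
    then have "exp (2 * b\<^sup>2 / (1 - 4 * a)) * (1 / sqrt (1 - 4 * a))
      \<le> exp (3 * b\<^sup>2 + b\<^sup>2 / (1 - 2 * a)) * (exp (6 * a\<^sup>2) / (1 - 2 * a))"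
      using b pos by (intro mult_mono) auto
    then show ?thesis by (simp add: exp_add mult_ac)
  qed
  also have "exp (b\<^sup>2 / (1 - 2 * a)) / (1 - 2 * a) = (exp (b\<^sup>2 / (2 * (1 - 2 * a))) / sqrt (1 - 2 * a))\<^sup>2"
  proof -
    have "z / q = 2 * (z / (2 * q))" for z q :: real by simp
    from this[of "b\<^sup>2" "1 - 2 * a"] show ?thesis
      using pos by (simp only: exp_double power_divide) simp
  qed
  also have "exp (b\<^sup>2 / (2 * (1 - 2 * a))) / sqrt (1 - 2 * a) = (\<integral>u. exp (a * u\<^sup>2 + b * u) \<partial>std_normal_distribution)"
    using pos by (subst std_normal_integral_exp_quadratic) auto
  finally show ?thesis .
qed

text \<open>Let \<open>X\<close> be the density of \<open>Q\<close>. Each difference of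
  \<open>P A\<close> and \<open>Q A\<close> is the expectation of \<open>1 - X\<close> on
  \<open>A\<close>, hence at most the root of \<open>E X\<^sup>2 - 1\<close>, the \<chi>-square
  divergence, which factorises over the coordinates. It is finite only for small coefficients; for
  \<open>s > 1 / 10\<close> the claim is trivial, as no distance exceeds 1.\<close>

lemma tv_dist_exp_quadratic_le:
  fixes P Q :: "'a measure" and Y :: "'a \<Rightarrow> 'i \<Rightarrow> real"
  assumes P: "prob_space P" and Q: "prob_space Q" and I: "finite I"
    and Y[measurable]: "Y \<in> measurable P (std_normal_PiM I)"
    and distr: "distr P (std_normal_PiM I) Y = std_normal_PiM I"
    and dens: "Q = density P (\<lambda>x. ennreal (exp (separable_quadratic I k a b (Y x))))"
    and s: "0 \<le> s" "s\<^sup>2 = (\<Sum>i\<in>I. 2 * (a i)\<^sup>2 + (b i)\<^sup>2)"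
  shows "tv_dist P Q \<le> 10 * s"
proof (cases "s \<le> 1 / 10")
  case False
  then show ?thesis using tv_dist_le_1[OF P Q] by (simp add: dens)
next
  case True
  interpret P: prob_space P by fact
  interpret Q: prob_space Q by fact
  interpret product_sigma_finite "\<lambda>_::'i. std_normal_distribution" by (rule prod_sigma_finite_std_normal)
  let ?N = std_normal_distribution and ?f = "separable_quadratic I k a b"
  let ?q = "\<lambda>i u. a i * u\<^sup>2 + b i * u"
  have f[measurable]: "?f \<in> borel_measurable (std_normal_PiM I)" using I by measurable
  have a: "\<bar>a i\<bar> \<le> 1 / 8" if "i \<in> I" for i
  proof -
    have "2 * (a i)\<^sup>2 \<le> 2 * (a i)\<^sup>2 + (b i)\<^sup>2" by simp
    also have "\<dots> \<le> s\<^sup>2"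
      unfolding s using I that by (intro member_le_sum[of i I "\<lambda>i. 2 * (a i)\<^sup>2 + (b i)\<^sup>2"]) auto
    also have "\<dots> \<le> (1 / 10)\<^sup>2" using True s by (intro power_mono) auto
    finally have "\<bar>a i\<bar>\<^sup>2 \<le> (1 / 8)\<^sup>2" by (simp add: power2_eq_square)
    then show ?thesis by (rule power2_le_imp_le) simp
  qed
  have int: "integrable ?N (\<lambda>u. exp (?q i u))" "integrable ?N (\<lambda>u. exp (2 * ?q i u))" if "i \<in> I" for i
    using std_normal_integrable_exp_quadratic[of "a i" "b i"]
      std_normal_integrable_exp_quadratic[of "2 * a i" "2 * b i"] a[OF that]
    by (auto simp: algebra_simps)
  have exp1: "exp (?f y) = exp k * (\<Prod>i\<in>I. exp (?q i (y i)))" for y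
    by (simp add: separable_quadratic_def exp_add exp_sum[OF I])
  have exp2: "(exp (?f y))\<^sup>2 = (exp k)\<^sup>2 * (\<Prod>i\<in>I. exp (2 * ?q i (y i)))" for y
    by (simp only: exp1 power_mult_distrib prod_power_distrib exp_double)
  have int1: "integrable (std_normal_PiM I) (\<lambda>y. exp (?f y))"
    unfolding exp1 using int by (intro integrable_mult_right product_integrable_prod I)
  have int2: "integrable (std_normal_PiM I) (\<lambda>y. (exp (?f y))\<^sup>2)"
    unfolding exp2 using int by (intro integrable_mult_right product_integrable_prod I)
  have PY: "(\<integral>x. g (Y x) \<partial>P) = (\<integral>y. g y \<partial>std_normal_PiM I)"
      "integrable (std_normal_PiM I) g \<Longrightarrow> integrable P (\<lambda>x. g (Y x))"
    if [measurable]: "g \<in> borel_measurable (std_normal_PiM I)" for g :: "_ \<Rightarrow> real"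
    using integral_distr[OF Y that] integrable_distr_eq[OF Y that] by (simp_all add: distr)
  define X where "X x = exp (?f (Y x))" for x
  have Xm[measurable]: "X \<in> borel_measurable P" unfolding X_def by measurable
  have X0: "0 \<le> X x" for x by (simp add: X_def)
  have X1: "integrable P X" and X2: "integrable P (\<lambda>x. (X x)\<^sup>2)"
    using PY(2)[OF _ int1] PY(2)[OF _ int2] by (simp_all add: X_def[abs_def])
  have QA: "measure Q A = (\<integral>x. X x * indicator A x \<partial>P)" if A[measurable]: "A \<in> sets P" for A
  proof -
    have "emeasure Q A = (\<integral>\<^sup>+x. ennreal (X x) * indicator A x \<partial>P)"
      unfolding dens X_def by (subst emeasure_density) auto
    then have "ennreal (measure Q A) = (\<integral>\<^sup>+x. ennreal (X x) * indicator A x \<partial>P)"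
      by (simp only: Q.emeasure_eq_measure)
    also have "\<dots> = (\<integral>\<^sup>+x. ennreal (X x * indicator A x) \<partial>P)"
      by (intro nn_integral_cong) (auto simp: indicator_def)
    also have "\<dots> = ennreal (\<integral>x. X x * indicator A x \<partial>P)"
      using X1 by (intro nn_integral_eq_integral integrable_real_mult_indicator) (auto simp: X0)
    finally show ?thesis by (simp add: X0 integral_nonneg_AE)
  qed
  have EX: "(\<integral>x. X x \<partial>P) = 1"
  proof -
    have "(\<integral>x. X x \<partial>P) = (\<integral>x. X x * indicator (space P) x \<partial>P)"
      by (intro Bochner_Integration.integral_cong) auto
    also have "\<dots> = measure Q (space Q)" by (subst QA[symmetric]) (auto simp: dens)
    finally show ?thesis by (simp add: Q.prob_space)
  qed
  \<comment> \<open>The total mass 1 of \<open>Q\<close> determines \<open>exp k\<close>. Comparing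
    second moments with squared first moments therefore makes \<open>k\<close> disappear from the
    final bound.\<close>
  have prod1: "exp k * (\<Prod>i\<in>I. \<integral>u. exp (?q i u) \<partial>?N) = 1"
  proof -
    have "1 = (\<integral>y. exp (?f y) \<partial>std_normal_PiM I)"
      using EX PY(1)[of "\<lambda>y. exp (?f y)"] by (simp add: X_def)
    also have "\<dots> = exp k * (\<Prod>i\<in>I. \<integral>u. exp (?q i u) \<partial>?N)"
      unfolding exp1 using int by (subst integral_mult_right_zero) (subst product_integral_prod[OF I], auto)
    finally show ?thesis ..
  qed
  \<comment> \<open>Permits \<open>exp x \<le> 1 + x + x\<^sup>2\<close> at
    \<open>x = 3 * s\<^sup>2\<close>, which gives the excess \<open>6 * s\<^sup>2\<close>. The
    constant 10 is generous; it matches the threshold \<open>1 / 10\<close> of the trivial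
    case.\<close>
  have s3: "3 * s\<^sup>2 \<le> 1"
    using power_mono[OF True s(1), of 2] by (simp add: power_divide)
  have EX2: "(\<integral>x. (X x)\<^sup>2 \<partial>P) \<le> 1 + 6 * s\<^sup>2"
  proof -
    have "(\<integral>x. (X x)\<^sup>2 \<partial>P) = (exp k)\<^sup>2 * (\<Prod>i\<in>I. \<integral>u. exp (2 * ?q i u) \<partial>?N)"
    proof -
      have "(\<integral>x. (X x)\<^sup>2 \<partial>P) = (\<integral>y. (exp (?f y))\<^sup>2 \<partial>std_normal_PiM I)"
        unfolding X_def by (rule PY(1)) measurable
      also have "\<dots> = (exp k)\<^sup>2 * (\<Prod>i\<in>I. \<integral>u. exp (2 * ?q i u) \<partial>?N)"
        unfolding exp2 using int(2)
        by (subst integral_mult_right_zero, subst product_integral_prod[OF I]) auto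
      finally show ?thesis .
    qed
    also have "\<dots> \<le> (exp k)\<^sup>2 * (\<Prod>i\<in>I. exp (6 * (a i)\<^sup>2 + 3 * (b i)\<^sup>2) * (\<integral>u. exp (?q i u) \<partial>?N)\<^sup>2)"
      using std_normal_chi_square_factor_le[OF a]
      by (intro mult_left_mono prod_mono conjI) (auto intro!: integral_nonneg_AE)
    also have "\<dots> = (\<Prod>i\<in>I. exp (6 * (a i)\<^sup>2 + 3 * (b i)\<^sup>2)) * (exp k * (\<Prod>i\<in>I. \<integral>u. exp (?q i u) \<partial>?N))\<^sup>2"
      by (simp add: prod.distrib power_mult_distrib prod_power_distrib)
    also have "\<dots> = exp (3 * s\<^sup>2)"
      unfolding prod1 by (simp add: exp_sum[OF I, symmetric] s sum_distrib_left distrib_left)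
    also have "\<dots> \<le> 1 + 3 * s\<^sup>2 + (3 * s\<^sup>2)\<^sup>2"
      using s3 by (intro exp_bound) simp_all
    also have "(3 * s\<^sup>2)\<^sup>2 \<le> 3 * s\<^sup>2 * 1"
      unfolding power2_eq_square[of "3 * s\<^sup>2"] by (intro mult_left_mono s3) simp
    finally show ?thesis by simp
  qed
  show ?thesis
  proof (rule tv_dist_leI[OF P Q])
    show "sets P = sets Q" by (simp add: dens)
    fix A assume A[measurable]: "A \<in> sets P"
    define Z where "Z x = (1 - X x) * indicator A x" for x
    have [measurable]: "Z \<in> borel_measurable P" unfolding Z_def by measurable
    have Zle: "(Z x)\<^sup>2 \<le> 1 - 2 * X x + (X x)\<^sup>2" for x
    proof -
      have "1 - 2 * X x + (X x)\<^sup>2 = (1 - X x)\<^sup>2" by (simp add: power2_diff)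
      then show ?thesis unfolding Z_def by (cases "x \<in> A") auto
    qed
    have iZ: "integrable P Z"
      unfolding Z_def using X1 A by (intro integrable_real_mult_indicator) auto
    have ib: "integrable P (\<lambda>x. 1 - 2 * X x + (X x)\<^sup>2)" using X1 X2 by auto
    have iZ2: "integrable P (\<lambda>x. (Z x)\<^sup>2)"
      using ib by (rule Bochner_Integration.integrable_bound) (use Zle in \<open>auto intro: order_trans[OF _ abs_ge_self]\<close>)
    have "measure P A - measure Q A = (\<integral>x. indicator A x \<partial>P) - (\<integral>x. X x * indicator A x \<partial>P)"
      using QA[OF A] A by simp
    also have "\<dots> = (\<integral>x. Z x \<partial>P)"
      unfolding Z_def using X1 A
      by (subst Bochner_Integration.integral_diff[symmetric])
         (auto simp: left_diff_distrib less_top[symmetric] intro!: integrable_real_mult_indicator)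
    finally have d: "measure P A - measure Q A = P.expectation Z" .
    have "(P.expectation Z)\<^sup>2 \<le> P.expectation (\<lambda>x. (Z x)\<^sup>2)"
      using P.variance_eq[OF iZ iZ2] P.variance_positive[of Z] by simp
    also have "\<dots> \<le> P.expectation (\<lambda>x. 1 - 2 * X x + (X x)\<^sup>2)"
      using iZ2 ib Zle by (rule integral_mono)
    also have "\<dots> = 1 - 2 * 1 + P.expectation (\<lambda>x. (X x)\<^sup>2)"
      using X1 X2 EX by (simp add: P.prob_space)
    also have "\<dots> \<le> (10 * s)\<^sup>2"
    proof -
      have "(10 * s)\<^sup>2 = 100 * s\<^sup>2" by (simp add: power_mult_distrib)
      then show ?thesis using EX2 zero_le_power2[of s] by linarith
    qed
    finally have "\<bar>P.expectation Z\<bar>\<^sup>2 \<le> (10 * s)\<^sup>2" by simp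
    then show "\<bar>measure P A - measure Q A\<bar> \<le> 10 * s"
      unfolding d by (rule power2_le_imp_le) (use s in simp)
  qed
qed

text \<open>The constant is \<open>144 * 12 * 10\<close>. The radius
  \<open>\<alpha>\<^sup>2 * s / 144\<close> makes the small-ball bound
  \<open>6 * sqrt (e / s)\<close> equal to \<open>\<alpha> / 2\<close>, the conditioned distance is
  at least \<open>e / 12\<close>, and the unconditioned one is at most
  \<open>10 * s\<close>.\<close>

theorem tv_dist_conditioned_exp_quadratic_ge:
  fixes P Q :: "'a measure" and Y :: "'a \<Rightarrow> 'i \<Rightarrow> real"
  assumes P: "prob_space P" and Q: "prob_space Q" and I: "finite I"
    and Y[measurable]: "Y \<in> measurable P (std_normal_PiM I)"
    and distr: "distr P (std_normal_PiM I) Y = std_normal_PiM I"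
    and dens: "Q = density P (\<lambda>x. ennreal (exp (separable_quadratic I k a b (Y x))))"
    and S[measurable]: "S \<in> sets P" and T[measurable]: "T \<in> sets P"
    and \<alpha>: "0 < \<alpha>" "\<alpha> \<le> 1" and mass: "\<alpha> \<le> measure P S" "\<alpha> \<le> measure Q T"
  shows "\<alpha>\<^sup>2 / 17280 * tv_dist P Q \<le> tv_dist (uniform_measure P S) (uniform_measure Q T)"
proof -
  interpret P: prob_space P by fact
  interpret Q: prob_space Q by fact
  let ?f = "\<lambda>x. separable_quadratic I k a b (Y x)"
  let ?tv = "tv_dist (uniform_measure P S) (uniform_measure Q T)"
  have [measurable]: "separable_quadratic I k a b \<in> borel_measurable (std_normal_PiM I)" using I by measurable
  have f[measurable]: "?f \<in> borel_measurable P" by measurable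
  define s where "s = sqrt (\<Sum>i\<in>I. 2 * (a i)\<^sup>2 + (b i)\<^sup>2)"
  have "0 \<le> (\<Sum>i\<in>I. 2 * (a i)\<^sup>2 + (b i)\<^sup>2)" by (intro sum_nonneg) auto
  then have s2: "s\<^sup>2 = (\<Sum>i\<in>I. 2 * (a i)\<^sup>2 + (b i)\<^sup>2)" and s0: "0 \<le> s"
    unfolding s_def by (rule real_sqrt_pow2, rule real_sqrt_ge_zero)
  have upper: "tv_dist P Q \<le> 10 * s"
    by (rule tv_dist_exp_quadratic_le[OF P Q I Y distr dens s0 s2])
  have upper1: "tv_dist P Q \<le> 1" using tv_dist_le_1[OF P Q] by (simp add: dens)
  have pos: "0 < measure P S" "0 < measure Q T" using \<alpha> mass by auto
  have [simp]: "sets Q = sets P" by (simp add: dens)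
  have D: "prob_space (uniform_measure P S)" "prob_space (uniform_measure Q T)"
      "sets (uniform_measure P S) = sets (uniform_measure Q T)"
    using pos by (auto intro!: prob_space_uniform_measure simp: P.emeasure_eq_measure Q.emeasure_eq_measure)
  show ?thesis
  \<comment> \<open>For \<open>s = 0\<close> the density ratio is constant and has no small-ball
    bound, but then \<open>P\<close> and \<open>Q\<close> are at distance 0.\<close>
  proof (cases "s = 0")
    case True
    then have "\<alpha>\<^sup>2 / 17280 * tv_dist P Q \<le> 0"
      using upper by (intro mult_nonneg_nonpos) auto
    then show ?thesis using tv_dist_nonneg[OF D] by linarith
  next
    case False
    then have s: "0 < s" using s0 by simp
    define e where "e = min 1 (\<alpha>\<^sup>2 * s / 144)"
    have e: "0 < e" "e \<le> 1" "e \<le> \<alpha>\<^sup>2 * s / 144" using s \<alpha> by (auto simp: e_def)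
    have "measure P {x \<in> space P. \<bar>?f x - c\<bar> \<le> e} \<le> measure P S / 2" for c
    proof -
      have "(\<integral>x. iexp (t * ?f x) \<partial>P) = (\<integral>y. iexp (t * separable_quadratic I k a b y) \<partial>std_normal_PiM I)" for t
        using integral_distr[OF Y, of "\<lambda>y. iexp (t * separable_quadratic I k a b y)"] by (simp add: distr)
      then have "measure P {x \<in> space P. \<bar>?f x - c\<bar> \<le> e} \<le> 6 * sqrt (e / s)"
        using norm_char_separable_quadratic_le[OF I, of _ k a b]
        by (intro P.small_ball_of_char_bound f s e) (simp add: s2)
      also have "sqrt (e / s) \<le> sqrt ((\<alpha> / 12)\<^sup>2)"
        using e s by (intro real_sqrt_le_mono) (simp add: power_divide field_simps)
      also have "\<dots> = \<alpha> / 12" using \<alpha> by (subst real_sqrt_abs) simp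
      finally show ?thesis using mass by simp
    qed
    then have lower: "e / 12 \<le> ?tv"
      by (rule tv_dist_conditioned_ge[OF P Q dens f S T pos e(1,2)])
    have "\<alpha>\<^sup>2 / 17280 * tv_dist P Q \<le> e / 12"
    \<comment> \<open>Once the radius is capped at 1, \<open>s\<close> is so large that
      \<open>10 * s\<close> says nothing, and the trivial bound 1 on the unconditioned distance
      takes over.\<close>
    proof (cases "\<alpha>\<^sup>2 * s / 144 \<le> 1")
      case True
      have "\<alpha>\<^sup>2 / 17280 * tv_dist P Q \<le> \<alpha>\<^sup>2 / 17280 * (10 * s)"
        using upper by (intro mult_left_mono) auto
      then show ?thesis using True by (simp add: e_def mult_ac)
    next
      case False
      have "\<alpha>\<^sup>2 \<le> 1" using \<alpha> by (simp add: power_le_one)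
      then have "\<alpha>\<^sup>2 / 17280 * tv_dist P Q \<le> 1 / 17280 * 1"
        using upper1 tv_dist_nonneg[OF P Q] by (intro mult_mono) (auto simp: dens)
      moreover have "e = 1" using False by (simp add: e_def)
      ultimately show ?thesis by (simp add: mult_ac)
    qed
    then show ?thesis using lower by (rule order_trans)
  qed
qed

section \<open>The real spectral theorem\<close>

text \<open>Over the complex numbers the characteristic polynomial has a root; symmetry of the real
  matrix forces the root to be real, and so it is a root of the real characteristic
  polynomial.\<close>

lemma real_symmetric_has_eigenvalue:
  fixes A :: "real mat"
  assumes A: "A \<in> carrier_mat n n" and sym: "transpose_mat A = A" and "0 < n"
  shows "\<exists>e. eigenvalue A e"
proof -
  define B where "B = map_mat complex_of_real A"
  have B: "B \<in> carrier_mat n n" using A by (simp add: B_def)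
  have symB: "transpose_mat B = B"
    using sym unfolding B_def by (metis map_mat_transpose)
  obtain as where as: "char_poly B = (\<Prod>a\<leftarrow>as. [:- a, 1:])" "length as = n"
    using char_poly_factorized[OF B] by blast
  then obtain a as' where "as = a # as'" using \<open>0 < n\<close> by (cases as) auto
  then have root: "poly (char_poly B) a = 0" by (simp add: as)
  then obtain v where v: "v \<in> carrier_vec n" "v \<noteq> 0\<^sub>v n" "B *\<^sub>v v = a \<cdot>\<^sub>v v"
    using eigenvalue_root_char_poly[OF B] B unfolding eigenvalue_def eigenvector_def by auto
  have cB: "conjugate (B *\<^sub>v v) = B *\<^sub>v conjugate v"
  proof (rule eq_vecI)
    fix i assume i: "i < dim_vec (B *\<^sub>v conjugate v)"
    show "conjugate (B *\<^sub>v v) $ i = (B *\<^sub>v conjugate v) $ i"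
      using i A v(1) by (auto simp: scalar_prod_def B_def sum_conjugate intro!: sum.cong)
  qed auto
  have Bv: "B *\<^sub>v v \<in> carrier_vec n" using B v by auto
  \<comment> \<open>Moving the matrix from one side of the Hermitian form to the other evaluates the
    same number once with \<open>a\<close> and once with \<open>cnj a\<close>.\<close>
  have "a * (v \<bullet>c v) = (B *\<^sub>v v) \<bullet>c v" using v by simp
  also have "\<dots> = conjugate v \<bullet> (B *\<^sub>v v)"
    using v Bv by (simp add: comm_scalar_prod[of _ n])
  also have "\<dots> = (transpose_mat B *\<^sub>v conjugate v) \<bullet> v"
    using v B transpose_vec_mult_scalar[OF B v(1), of "conjugate v"] by simp
  also have "\<dots> = conjugate (a \<cdot>\<^sub>v v) \<bullet> v" using symB cB v by simp
  also have "\<dots> = cnj a * (v \<bullet>c v)"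
    using v by (simp add: conjugate_smult_vec comm_scalar_prod[of _ n])
  finally have "a * (v \<bullet>c v) = cnj a * (v \<bullet>c v)" .
  moreover have "v \<bullet>c v \<noteq> 0" using v by simp
  ultimately have "cnj a = a" by simp
  then obtain r where r: "a = of_real r" by (metis Reals_cases Reals_cnj_iff)
  have "poly (map_poly of_real (char_poly A)) (complex_of_real r) = 0"
    using root r A unfolding B_def by (simp add: of_real_hom.char_poly_hom)
  then have "poly (char_poly A) r = 0" by simp
  then show ?thesis using eigenvalue_root_char_poly[OF A] by blast
qed

text \<open>Gram-Schmidt applied to a basis that begins with \<open>v\<close> keeps \<open>v\<close>
  in front; the normalised vectors are the columns. The factor \<open>c\<close> may stay
  unspecified, since the eigenvector equation is homogeneous.\<close>

lemma orthonormal_extension: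
  fixes v :: "real vec"
  assumes v: "v \<in> carrier_vec n" "v \<noteq> 0\<^sub>v n" and n: "0 < n"
  obtains U c where "U \<in> carrier_mat n n" "transpose_mat U * U = 1\<^sub>m n" "col U 0 = c \<cdot>\<^sub>v v"
proof -
  interpret cof_vec_space n "TYPE(real)" .
  define ws where "ws = gram_schmidt n (basis_completion v)"
  note b = basis_completion[OF v]
  obtain vs where bv: "basis_completion v = v # vs"
    using b n by (cases "basis_completion v") auto
  have ws: "set ws \<subseteq> carrier_vec n" "corthogonal ws" "length ws = n"
    using gram_schmidt_result[OF _ _ _ ws_def] b by auto
  have hd: "hd ws = v" using gram_schmidt_hd[OF v(1), of vs] by (simp add: ws_def bv)
  define U where "U = mat_of_cols n (map (\<lambda>w. (1 / sqrt (w \<bullet> w)) \<cdot>\<^sub>v w) ws)"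
  have U: "U \<in> carrier_mat n n" using ws by (simp add: U_def mat_of_cols_def)
  have wsc: "ws ! i \<in> carrier_vec n" if "i < n" for i using ws that by auto
  have col: "col U i = (1 / sqrt (ws ! i \<bullet> ws ! i)) \<cdot>\<^sub>v ws ! i" if "i < n" for i
    using that ws wsc unfolding U_def by (subst col_mat_of_cols) auto
  have conj: "conjugate w = w" for w :: "real vec" by (intro eq_vecI) auto
  have "transpose_mat U * U = 1\<^sub>m n"
  proof (rule eq_matI)
    fix i j assume "i < dim_row (1\<^sub>m n :: real mat)" "j < dim_col (1\<^sub>m n :: real mat)"
    then have ij: "i < n" "j < n" by auto
    have "(transpose_mat U * U) $$ (i,j) = col U i \<bullet> col U j" using U ij by simp
    also have "\<dots> = (ws ! i \<bullet> ws ! j) / (sqrt (ws ! i \<bullet> ws ! i) * sqrt (ws ! j \<bullet> ws ! j))"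
      using ij wsc[OF ij(1)] wsc[OF ij(2)]
      by (simp add: col smult_scalar_prod_distrib[of _ n] scalar_prod_smult_distrib[of _ n])
    also have "\<dots> = (if i = j then 1 else 0)"
    proof (cases "i = j")
      case True
      have "ws ! i \<bullet> ws ! i \<noteq> 0"
        using corthogonalD[OF ws(2), of i i] ij ws(3) by (simp add: conj)
      moreover have "ws ! i \<bullet> ws ! i \<ge> 0" by (auto simp: scalar_prod_def intro!: sum_nonneg)
      ultimately show ?thesis using True by simp
    next
      case False
      then show ?thesis using corthogonalD[OF ws(2), of i j] ij ws(3) by (simp add: conj)
    qed
    finally show "(transpose_mat U * U) $$ (i,j) = 1\<^sub>m n $$ (i,j)" using ij by simp
  qed (use U in auto)
  moreover have "ws ! 0 = v" using hd ws n by (cases ws) auto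
  then have "col U 0 = (1 / sqrt (v \<bullet> v)) \<cdot>\<^sub>v v" using col[OF n] by simp
  ultimately show ?thesis using that U by blast
qed

text \<open>Deflation: in an orthonormal basis that starts with an eigenvector, the first column is
  zero below the diagonal, symmetry clears the first row, and the remaining block is a smaller
  symmetric matrix.\<close>

theorem real_spectral:
  fixes A :: "real mat"
  assumes "A \<in> carrier_mat n n" "transpose_mat A = A"
  obtains U l where "U \<in> carrier_mat n n" "transpose_mat U * U = 1\<^sub>m n"
    "transpose_mat U * A * U = Matrix.mat n n (\<lambda>(i,j). if i = j then l i else 0)"
proof -
  have "\<exists>U l. U \<in> carrier_mat n n \<and> transpose_mat U * U = 1\<^sub>m n \<and>
    transpose_mat U * A * U = Matrix.mat n n (\<lambda>(i,j). if i = j then l i else (0::real))"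
    using assms
  proof (induction n arbitrary: A)
    case 0
    then show ?case by (intro exI[of _ "1\<^sub>m 0"] exI[of _ "\<lambda>_. 0"]) auto
  next
    case (Suc n)
    note A = Suc.prems
    obtain e where "eigenvalue A e" using real_symmetric_has_eigenvalue[OF A] by auto
    then obtain v where v: "v \<in> carrier_vec (Suc n)" "v \<noteq> 0\<^sub>v (Suc n)" "A *\<^sub>v v = e \<cdot>\<^sub>v v"
      using A unfolding eigenvalue_def eigenvector_def by auto
    obtain W c where W: "W \<in> carrier_mat (Suc n) (Suc n)" "transpose_mat W * W = 1\<^sub>m (Suc n)"
      and c: "col W 0 = c \<cdot>\<^sub>v v" using orthonormal_extension[OF v(1,2)] by blast
    define B where "B = transpose_mat W * A * W"
    have B: "B \<in> carrier_mat (Suc n) (Suc n)" using W A by (auto simp: B_def)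
    have Bsym: "transpose_mat B = B"
    proof -
      have "transpose_mat B = transpose_mat W * transpose_mat (transpose_mat W * A)"
        unfolding B_def by (rule transpose_mult) (use W A in auto)
      also have "transpose_mat (transpose_mat W * A) = A * W"
        using transpose_mult[of "transpose_mat W" "Suc n" "Suc n" A "Suc n"] W A by auto
      finally show ?thesis unfolding B_def using W A by (simp add: assoc_mult_mat)
    qed
    have col0: "col B 0 = e \<cdot>\<^sub>v unit_vec (Suc n) 0"
    proof -
      have "col B 0 = transpose_mat W * A *\<^sub>v col W 0" using W A unfolding B_def by (intro col_mult2) auto
      also have "\<dots> = transpose_mat W *\<^sub>v (A *\<^sub>v col W 0)" using W A v c by (auto intro!: assoc_mult_mat_vec)
      also have "A *\<^sub>v col W 0 = e \<cdot>\<^sub>v col W 0"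
        using c v A by (simp add: mult_mat_vec smult_smult_assoc mult.commute)
      also have "transpose_mat W *\<^sub>v (e \<cdot>\<^sub>v col W 0) = e \<cdot>\<^sub>v (transpose_mat W *\<^sub>v col W 0)"
        using W c v by (intro mult_mat_vec) auto
      also have "transpose_mat W *\<^sub>v col W 0 = col (transpose_mat W * W) 0"
        using W by (intro col_mult2[symmetric]) auto
      finally show ?thesis using W by simp
    qed
    have B0: "B $$ (i,0) = (if i = 0 then e else 0)" if "i < Suc n" for i
      using arg_cong[OF col0, of "\<lambda>v. v $ i"] that B by (auto simp: unit_vec_def)
    have B0': "B $$ (0,i) = (if i = 0 then e else 0)" if "i < Suc n" for i
      using B0[OF that] arg_cong[OF Bsym, of "\<lambda>M. M $$ (0,i)"] B that by simp
    define C where "C = Matrix.mat n n (\<lambda>(i,j). B $$ (Suc i, Suc j))"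
    have C: "C \<in> carrier_mat n n" by (simp add: C_def)
    have Csym: "transpose_mat C = C"
    proof (rule eq_matI)
      fix i j assume "i < dim_row C" "j < dim_col C"
      then show "transpose_mat C $$ (i,j) = C $$ (i,j)"
        using arg_cong[OF Bsym, of "\<lambda>M. M $$ (Suc i, Suc j)"] B by (simp add: C_def)
    qed (auto simp: C_def)
    have Bblock: "B = four_block_mat (Matrix.mat 1 1 (\<lambda>_. e)) (0\<^sub>m 1 n) (0\<^sub>m n 1) C"
    proof (rule eq_matI)
      fix i j assume "i < dim_row (four_block_mat (Matrix.mat 1 1 (\<lambda>_. e)) (0\<^sub>m 1 n) (0\<^sub>m n 1) C)"
        "j < dim_col (four_block_mat (Matrix.mat 1 1 (\<lambda>_. e)) (0\<^sub>m 1 n) (0\<^sub>m n 1) C)"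
      then have "i < Suc n" "j < Suc n" using C by auto
      then show "B $$ (i,j) = four_block_mat (Matrix.mat 1 1 (\<lambda>_. e)) (0\<^sub>m 1 n) (0\<^sub>m n 1) C $$ (i,j)"
        using B0 B0' by (cases i; cases j) (auto simp: C_def)
    qed (use B C in auto)
    obtain V l where V: "V \<in> carrier_mat n n" "transpose_mat V * V = 1\<^sub>m n"
      and VC: "transpose_mat V * C * V = Matrix.mat n n (\<lambda>(i,j). if i = j then l i else (0::real))"
      using Suc.IH[OF C Csym] by blast
    \<comment> \<open>Diagonalises the smaller block and fixes the first basis vector, so the
      eigenvector already split off is left alone.\<close>
    define X where "X = four_block_mat (1\<^sub>m 1) (0\<^sub>m 1 n) (0\<^sub>m n 1) V"
    have X: "X \<in> carrier_mat (Suc n) (Suc n)" using V by (auto simp: X_def)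
    have Xt: "transpose_mat X = four_block_mat (1\<^sub>m 1) (0\<^sub>m 1 n) (0\<^sub>m n 1) (transpose_mat V)"
      unfolding X_def using V by (subst transpose_four_block_mat[of _ 1 1 _ n _ n]) auto
    have XX: "transpose_mat X * X = 1\<^sub>m (Suc n)"
    proof -
      have "transpose_mat X * X = four_block_mat (1\<^sub>m 1) (0\<^sub>m 1 n) (0\<^sub>m n 1) (1\<^sub>m n)"
        unfolding Xt unfolding X_def using V by (subst mult_four_block_mat[of _ 1 1 _ n _ n]) auto
      then show ?thesis by simp
    qed
    have XBX: "transpose_mat X * B * X = four_block_mat (Matrix.mat 1 1 (\<lambda>_. e)) (0\<^sub>m 1 n) (0\<^sub>m n 1)
      (transpose_mat V * C * V)"
    proof -
      have "transpose_mat X * B = four_block_mat (Matrix.mat 1 1 (\<lambda>_. e)) (0\<^sub>m 1 n) (0\<^sub>m n 1)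
        (transpose_mat V * C)"
        unfolding Xt Bblock using V C by (subst mult_four_block_mat[of _ 1 1 _ n _ n]) auto
      then show ?thesis
        unfolding X_def using V C by (simp, subst mult_four_block_mat[of _ 1 1 _ n _ n]) auto
    qed
    define U where "U = W * X"
    define k where "k i = (case i of 0 \<Rightarrow> e | Suc j \<Rightarrow> l j)" for i
    have Ut: "transpose_mat U = transpose_mat X * transpose_mat W"
      unfolding U_def using W(1) X by (rule transpose_mult)
    have "transpose_mat U * U = transpose_mat X * (transpose_mat W * W) * X"
      unfolding Ut unfolding U_def using W(1) X
      by (simp add: assoc_mult_mat[of _ "Suc n" "Suc n" _ "Suc n" _ "Suc n"])
    then have "transpose_mat U * U = 1\<^sub>m (Suc n)" using W X XX by simp
    moreover have "transpose_mat U * A * U = transpose_mat X * B * X"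
      unfolding Ut unfolding U_def B_def using W(1) X A
      by (simp add: assoc_mult_mat[of _ "Suc n" "Suc n" _ "Suc n" _ "Suc n"])
    then have "transpose_mat U * A * U = Matrix.mat (Suc n) (Suc n) (\<lambda>(i,j). if i = j then k i else 0)"
      unfolding XBX VC k_def by (auto intro!: eq_matI split: nat.splits)
    ultimately show ?case using W X by (intro exI[of _ U] exI[of _ k]) (auto simp: U_def)
  qed
  then show ?thesis using that by blast
qed

section \<open>Linear images of Lebesgue and Gaussian measure\<close>

lemma distr_PiM_componentwise:
  fixes M :: "'i \<Rightarrow> 'a measure" and N :: "'i \<Rightarrow> 'b measure"
  assumes I: "finite I" and M: "\<And>i. sigma_finite_measure (M i)" and N: "\<And>i. sigma_finite_measure (N i)"
    and f[measurable]: "\<And>i. i \<in> I \<Longrightarrow> f i \<in> measurable (M i) (N i)"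
    and distr: "\<And>i. i \<in> I \<Longrightarrow> distr (M i) (N i) (f i) = N i"
  shows "distr (Pi\<^sub>M I M) (Pi\<^sub>M I N) (\<lambda>x. \<lambda>i\<in>I. f i (x i)) = Pi\<^sub>M I N"
proof -
  interpret M: product_sigma_finite M by (simp add: product_sigma_finite_def M)
  interpret N: product_sigma_finite N by (simp add: product_sigma_finite_def N)
  have meas: "(\<lambda>x. \<lambda>i\<in>I. f i (x i)) \<in> measurable (Pi\<^sub>M I M) (Pi\<^sub>M I N)"
    by (intro measurable_restrict) measurable
  show ?thesis
  proof (rule N.PiM_eqI[OF I])
    fix A assume A: "\<And>i. i \<in> I \<Longrightarrow> A i \<in> sets (N i)"
    have "(\<lambda>x. \<lambda>i\<in>I. f i (x i)) -` Pi\<^sub>E I A \<inter> space (Pi\<^sub>M I M) = Pi\<^sub>E I (\<lambda>i. f i -` A i \<inter> space (M i))"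
      by (auto simp: space_PiM PiE_iff extensional_def)
    then have "emeasure (distr (Pi\<^sub>M I M) (Pi\<^sub>M I N) (\<lambda>x. \<lambda>i\<in>I. f i (x i))) (Pi\<^sub>E I A) =
      emeasure (Pi\<^sub>M I M) (Pi\<^sub>E I (\<lambda>i. f i -` A i \<inter> space (M i)))"
      using A I meas by (subst emeasure_distr) (auto intro!: sets_PiM_I_finite)
    also have "\<dots> = (\<Prod>i\<in>I. emeasure (M i) (f i -` A i \<inter> space (M i)))"
      using A f I by (intro M.emeasure_PiM) (auto intro: measurable_sets)
    also have "\<dots> = (\<Prod>i\<in>I. emeasure (N i) (A i))"
    proof (rule prod.cong)
      fix i assume i: "i \<in> I"
      show "emeasure (M i) (f i -` A i \<inter> space (M i)) = emeasure (N i) (A i)"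
        using emeasure_distr[OF f[OF i] A[OF i]] by (simp add: distr[OF i])
    qed simp
    finally show "emeasure (distr (Pi\<^sub>M I M) (Pi\<^sub>M I N) (\<lambda>x. \<lambda>i\<in>I. f i (x i))) (Pi\<^sub>E I A) = (\<Prod>i\<in>I. emeasure (N i) (A i))" .
  qed simp
qed

lemma density_PiM:
  fixes f :: "'i \<Rightarrow> 'a \<Rightarrow> ennreal"
  assumes I: "finite I" and M: "\<And>i. sigma_finite_measure (M i)"
    and N: "\<And>i. sigma_finite_measure (density (M i) (f i))"
    and f[measurable]: "\<And>i. f i \<in> borel_measurable (M i)"
  shows "Pi\<^sub>M I (\<lambda>i. density (M i) (f i)) = density (Pi\<^sub>M I M) (\<lambda>x. \<Prod>i\<in>I. f i (x i))"
proof -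
  interpret M: product_sigma_finite M by (simp add: product_sigma_finite_def M)
  interpret N: product_sigma_finite "\<lambda>i. density (M i) (f i)" by (simp add: product_sigma_finite_def N)
  show ?thesis
  proof (rule N.PiM_eqI[OF I, symmetric])
    show "sets (density (Pi\<^sub>M I M) (\<lambda>x. \<Prod>i\<in>I. f i (x i))) = sets (Pi\<^sub>M I (\<lambda>i. density (M i) (f i)))"
      by (simp cong: sets_PiM_cong)
    fix A assume "\<And>i. i \<in> I \<Longrightarrow> A i \<in> sets (density (M i) (f i))"
    then have A[measurable]: "\<And>i. i \<in> I \<Longrightarrow> A i \<in> sets (M i)" by simp
    have "emeasure (density (Pi\<^sub>M I M) (\<lambda>x. \<Prod>i\<in>I. f i (x i))) (Pi\<^sub>E I A) =
      (\<integral>\<^sup>+x. (\<Prod>i\<in>I. f i (x i)) * indicator (Pi\<^sub>E I A) x \<partial>Pi\<^sub>M I M)"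
      using I A by (intro emeasure_density sets_PiM_I_finite) auto
    also have "\<dots> = (\<integral>\<^sup>+x. (\<Prod>i\<in>I. f i (x i) * indicator (A i) (x i)) \<partial>Pi\<^sub>M I M)"
    proof (rule nn_integral_cong)
      fix x assume x: "x \<in> space (Pi\<^sub>M I M)"
      have "indicator (Pi\<^sub>E I A) x = (\<Prod>i\<in>I. indicator (A i) (x i) :: ennreal)"
        using x I by (auto simp: indicator_def space_PiM PiE_iff prod_zero_iff)
      then show "(\<Prod>i\<in>I. f i (x i)) * indicator (Pi\<^sub>E I A) x = (\<Prod>i\<in>I. f i (x i) * indicator (A i) (x i))"
        by (simp add: prod.distrib)
    qed
    also have "\<dots> = (\<Prod>i\<in>I. \<integral>\<^sup>+x. f i x * indicator (A i) x \<partial>M i)"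
      by (rule M.product_nn_integral_prod[OF I]) measurable
    also have "\<dots> = (\<Prod>i\<in>I. emeasure (density (M i) (f i)) (A i))"
      by (intro prod.cong refl emeasure_density[symmetric]) auto
    finally show "emeasure (density (Pi\<^sub>M I M) (\<lambda>x. \<Prod>i\<in>I. f i (x i))) (Pi\<^sub>E I A) =
      (\<Prod>i\<in>I. emeasure (density (M i) (f i)) (A i))" .
  qed
qed

lemma distr_density_comp:
  assumes [measurable]: "T \<in> measurable M N" "f \<in> borel_measurable N"
  shows "distr (density M (\<lambda>x. f (T x))) N T = density (distr M N T) f"
proof (rule measure_eqI)
  fix A assume "A \<in> sets (distr (density M (\<lambda>x. f (T x))) N T)"
  then have [measurable]: "A \<in> sets N" by simp
  show "emeasure (distr (density M (\<lambda>x. f (T x))) N T) A = emeasure (density (distr M N T) f) A"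
    by (simp add: emeasure_distr emeasure_density nn_integral_distr indicator_def
        cong: nn_integral_cong)
qed simp

section \<open>Translations and uniqueness of Haar measure\<close>

definition translate :: "nat \<Rightarrow> (nat \<Rightarrow> real) \<Rightarrow> (nat \<Rightarrow> real) \<Rightarrow> nat \<Rightarrow> real" where
  "translate d v x = (\<lambda>i\<in>{..<d}. x i + v i)"

text \<open>Shift and point may vary together, because the uniqueness argument integrates over both
  and exchanges the integrals.\<close>

lemma measurable_translate2 [measurable (raw)]:
  assumes [measurable]: "f \<in> measurable M (lborel_dim d)" "g \<in> measurable M (lborel_dim d)"
  shows "(\<lambda>x. translate d (f x) (g x)) \<in> measurable M (lborel_dim d)"
proof -
  have "(\<lambda>x. f x i) \<in> borel_measurable M" "(\<lambda>x. g x i) \<in> borel_measurable M" if "i < d" for i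
    using that measurable_component_singleton[of i "{..<d}" "\<lambda>_. lborel :: real measure"]
    by (auto intro!: measurable_compose[OF assms(1)] measurable_compose[OF assms(2)])
  then show ?thesis unfolding translate_def by (intro measurable_restrict) auto
qed

lemma measurable_translate [measurable]: "translate d v \<in> measurable (lborel_dim d) (lborel_dim d)"
  unfolding translate_def[abs_def] by (intro measurable_restrict) auto

text \<open>Signs are allowed so that the reflections taking \<open>y\<close> to
  \<open>x - y\<close> are covered along with the translations.\<close>

lemma distr_lborel_dim_affine:
  assumes c: "\<And>i. i < d \<Longrightarrow> \<bar>c i\<bar> = 1"
  shows "distr (lborel_dim d) (lborel_dim d) (\<lambda>x. \<lambda>i\<in>{..<d}. v i + c i * x i) = lborel_dim d"
proof (rule distr_PiM_componentwise)
  fix i assume i: "i \<in> {..<d}"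
  have "c i \<noteq> 0" using c[of i] i by auto
  then show "distr lborel lborel (\<lambda>x. v i + c i * x) = lborel"
    using lborel_real_affine[of "c i" "v i"] c[of i] i
    by (simp add: density_1 one_ennreal_def[symmetric] cong: distr_cong)
qed (auto intro: sigma_finite_lborel)

lemma distr_lborel_dim_translate: "distr (lborel_dim d) (lborel_dim d) (translate d v) = lborel_dim d"
  using distr_lborel_dim_affine[of d "\<lambda>_. 1" v] by (simp add: translate_def[abs_def] add.commute)

lemma sigma_finite_lborel_dim: "sigma_finite_measure (lborel_dim d)"
proof -
  interpret product_sigma_finite "\<lambda>_::nat. lborel :: real measure" by standard
  show ?thesis by (rule sigma_finite) simp
qed

text \<open>Uniqueness of Haar measure: \<open>\<nu> A * \<lambda> B\<close> is the integral of \<open>1\<^sub>A(x) 1\<^sub>B(x + y)\<close> over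
  \<open>\<nu> \<otimes> \<lambda>\<close>, and substituting \<open>x - y\<close> for \<open>x\<close> turns it into \<open>\<nu> B * \<lambda> A\<close>.\<close>

lemma translation_invariant_unique:
  assumes nu: "sigma_finite_measure \<nu>" and sets[measurable_cong]: "sets \<nu> = sets (lborel_dim d)"
    and inv: "\<And>v. v \<in> space (lborel_dim d) \<Longrightarrow> distr \<nu> (lborel_dim d) (translate d v) = \<nu>"
    and A[measurable]: "A \<in> sets (lborel_dim d)" and B[measurable]: "B \<in> sets (lborel_dim d)"
  shows "emeasure \<nu> A * emeasure (lborel_dim d) B = emeasure \<nu> B * emeasure (lborel_dim d) A"
proof -
  let ?L = "lborel_dim d"
  let ?neg = "\<lambda>y. \<lambda>i\<in>{..<d}. - y i :: real"
  interpret nu: sigma_finite_measure \<nu> by fact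
  interpret L: sigma_finite_measure ?L by (rule sigma_finite_lborel_dim)
  interpret P: pair_sigma_finite \<nu> ?L ..
  have sp: "space \<nu> = space ?L" using sets by (rule sets_eq_imp_space_eq)
  have neg[measurable]: "?neg \<in> measurable ?L ?L" by (intro measurable_restrict) auto
  have neg_sp: "?neg y \<in> space ?L" for y by (simp add: space_PiM)
  have "emeasure \<nu> A * emeasure ?L B = (\<integral>\<^sup>+x. indicator A x * emeasure ?L B \<partial>\<nu>)"
    by (simp add: nn_integral_multc sets)
  also have "\<dots> = (\<integral>\<^sup>+x. (\<integral>\<^sup>+y. indicator A x * indicator B (translate d x y) \<partial>?L) \<partial>\<nu>)"
  proof (rule nn_integral_cong)
    fix x
    have "emeasure ?L B = (\<integral>\<^sup>+y. indicator B y \<partial>distr ?L ?L (translate d x))"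
      unfolding distr_lborel_dim_translate by simp
    also have "\<dots> = (\<integral>\<^sup>+y. indicator B (translate d x y) \<partial>?L)" by (rule nn_integral_distr) auto
    finally show "indicator A x * emeasure ?L B = (\<integral>\<^sup>+y. indicator A x * indicator B (translate d x y) \<partial>?L)"
      by (simp add: nn_integral_cmult)
  qed
  also have "\<dots> = (\<integral>\<^sup>+y. (\<integral>\<^sup>+x. indicator A x * indicator B (translate d x y) \<partial>\<nu>) \<partial>?L)"
    by (rule P.Fubini'[symmetric]) measurable
  also have "\<dots> = (\<integral>\<^sup>+y. (\<integral>\<^sup>+x. indicator A (translate d (?neg y) x) * indicator B x \<partial>\<nu>) \<partial>?L)"
  proof (rule nn_integral_cong)
    fix y assume y: "y \<in> space ?L"
    have "(\<integral>\<^sup>+x. indicator A x * indicator B (translate d x y) \<partial>\<nu>) =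
      (\<integral>\<^sup>+x. indicator A x * indicator B (translate d x y) \<partial>distr \<nu> ?L (translate d (?neg y)))"
      unfolding inv[OF neg_sp] ..
    also have "\<dots> = (\<integral>\<^sup>+x. indicator A (translate d (?neg y) x) * indicator B (translate d (translate d (?neg y) x) y) \<partial>\<nu>)"
      using y by (intro nn_integral_distr) measurable
    also have "\<dots> = (\<integral>\<^sup>+x. indicator A (translate d (?neg y) x) * indicator B x \<partial>\<nu>)"
    proof (rule nn_integral_cong)
      fix x assume "x \<in> space \<nu>"
      then have "translate d (translate d (?neg y) x) y = x"
        by (auto simp: sp space_PiM translate_def PiE_iff extensional_def fun_eq_iff)
      then show "indicator A (translate d (?neg y) x) * indicator B (translate d (translate d (?neg y) x) y) =
        (indicator A (translate d (?neg y) x) * indicator B x :: ennreal)" by simp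
    qed
    finally show "(\<integral>\<^sup>+x. indicator A x * indicator B (translate d x y) \<partial>\<nu>) =
      (\<integral>\<^sup>+x. indicator A (translate d (?neg y) x) * indicator B x \<partial>\<nu>)" .
  qed
  also have "\<dots> = (\<integral>\<^sup>+x. (\<integral>\<^sup>+y. indicator A (translate d (?neg y) x) * indicator B x \<partial>?L) \<partial>\<nu>)"
    by (rule P.Fubini') measurable
  \<comment> \<open>For fixed \<open>x\<close> the reflection taking \<open>y\<close> to
    \<open>x - y\<close> preserves Lebesgue measure, so the integral over \<open>y\<close> no longer
    depends on \<open>x\<close> except through \<open>B\<close>.\<close>
  also have "\<dots> = (\<integral>\<^sup>+x. emeasure ?L A * indicator B x \<partial>\<nu>)"
  proof (rule nn_integral_cong)
    fix x
    have e: "translate d (?neg y) x = (\<lambda>i\<in>{..<d}. x i + (- 1) * y i)" for y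
      by (auto simp: translate_def)
    have [measurable]: "(\<lambda>y. \<lambda>i\<in>{..<d}. x i + (- 1) * y i) \<in> measurable ?L ?L"
      by (intro measurable_restrict) measurable
    have "(\<integral>\<^sup>+y. indicator A (translate d (?neg y) x) \<partial>?L) =
      (\<integral>\<^sup>+y. indicator A y \<partial>distr ?L ?L (\<lambda>y. \<lambda>i\<in>{..<d}. x i + (- 1) * y i))"
      unfolding e by (rule nn_integral_distr[symmetric]) measurable
    also have "\<dots> = emeasure ?L A" by (subst distr_lborel_dim_affine) auto
    finally show "(\<integral>\<^sup>+y. indicator A (translate d (?neg y) x) * indicator B x \<partial>?L) = emeasure ?L A * indicator B x"
      unfolding e by (subst nn_integral_multc) measurable
  qed
  also have "\<dots> = emeasure \<nu> B * emeasure ?L A"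
    by (subst nn_integral_cmult_indicator) (simp_all add: sets mult.commute)
  finally show ?thesis .
qed

section \<open>Affine maps and rotation invariance\<close>

definition affine_map :: "nat \<Rightarrow> real vec \<Rightarrow> real mat \<Rightarrow> (nat \<Rightarrow> real) \<Rightarrow> nat \<Rightarrow> real" where
  "affine_map d v W x = (\<lambda>i\<in>{..<d}. (v + W *\<^sub>v Matrix.vec d x) $ i)"

lemma measurable_affine_map [measurable]:
  assumes W: "W \<in> carrier_mat d d"
  shows "affine_map d v W \<in> measurable (lborel_dim d) (lborel_dim d)"
  unfolding affine_map_def[abs_def]
proof (intro measurable_restrict)
  fix i assume "i \<in> {..<d}"
  then have e: "(v + W *\<^sub>v Matrix.vec d x) $ i = v $ i + (\<Sum>j\<in>{..<d}. W $$ (i,j) * x j)" for x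
    using W by (auto simp: scalar_prod_def lessThan_atLeast0)
  show "(\<lambda>x. (v + W *\<^sub>v Matrix.vec d x) $ i) \<in> measurable (lborel_dim d) lborel"
    unfolding e by measurable
qed

lemma affine_map_in_space [simp]: "affine_map d v W x \<in> space (lborel_dim d)"
  by (simp add: affine_map_def space_PiM)

lemma vec_affine_map:
  assumes "v \<in> carrier_vec d" "W \<in> carrier_mat d d"
  shows "Matrix.vec d (affine_map d v W x) = v + W *\<^sub>v Matrix.vec d x"
  using assms by (intro eq_vecI) (auto simp: affine_map_def)

lemma affine_map_comp:
  assumes "v \<in> carrier_vec d" "W \<in> carrier_mat d d" "u \<in> carrier_vec d" "V \<in> carrier_mat d d"
  shows "affine_map d v W (affine_map d u V x) = affine_map d (v + W *\<^sub>v u) (W * V) x"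
proof -
  have "v + W *\<^sub>v (u + V *\<^sub>v Matrix.vec d x) = v + W *\<^sub>v u + W * V *\<^sub>v Matrix.vec d x"
    using assms by (subst mult_add_distrib_mat_vec[of _ d d]) (auto simp: assoc_add_vec[of _ d] assoc_mult_mat_vec[of _ d d _ d])
  then show ?thesis unfolding affine_map_def[of _ v W] vec_affine_map[OF assms(3,4)] by (simp add: affine_map_def)
qed

lemma mult_mat_zero_vec: "W \<in> carrier_mat n d \<Longrightarrow> (W :: real mat) *\<^sub>v 0\<^sub>v d = 0\<^sub>v n"
  by (intro eq_vecI) (auto simp: scalar_prod_def)

lemma affine_map_id:
  assumes "x \<in> space (lborel_dim d)"
  shows "affine_map d (0\<^sub>v d) (1\<^sub>m d) x = x"
  using assms by (auto simp: affine_map_def space_PiM PiE_iff extensional_def fun_eq_iff)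

lemma sum_squares_eq_scalar_prod:
  "(\<Sum>i<d. (x i)\<^sup>2) = Matrix.vec d x \<bullet> Matrix.vec d (x :: nat \<Rightarrow> real)"
  by (simp add: scalar_prod_def lessThan_atLeast0 power2_eq_square)

lemma sum_squares_orthogonal:
  fixes U :: "real mat"
  assumes U: "U \<in> carrier_mat d d" "transpose_mat U * U = 1\<^sub>m d"
  shows "(\<Sum>i<d. (affine_map d (0\<^sub>v d) U x i)\<^sup>2) = (\<Sum>i<d. (x i)\<^sup>2)"
proof -
  let ?x = "Matrix.vec d x"
  have "(U *\<^sub>v ?x) \<bullet> (U *\<^sub>v ?x) = (transpose_mat U *\<^sub>v (U *\<^sub>v ?x)) \<bullet> ?x"
    using U by (subst transpose_vec_mult_scalar[of _ d d]) auto
  also have "transpose_mat U *\<^sub>v (U *\<^sub>v ?x) = ?x"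
    using U by (subst assoc_mult_mat_vec[symmetric, of _ d d _ d]) auto
  finally have "(U *\<^sub>v ?x) \<bullet> (U *\<^sub>v ?x) = ?x \<bullet> ?x" .
  then show ?thesis unfolding sum_squares_eq_scalar_prod using U by (simp add: vec_affine_map)
qed

lemma std_normal_PiM_eq_density:
  "std_normal_PiM {..<d} = density (lborel_dim d) (\<lambda>x. ennreal (exp (- (\<Sum>i<d. (x i)\<^sup>2) / 2) / sqrt (2 * pi) ^ d))"
proof -
  interpret N: real_distribution std_normal_distribution by (rule real_dist_normal_dist)
  have "std_normal_PiM {..<d} = density (lborel_dim d) (\<lambda>x. \<Prod>i<d. ennreal (std_normal_density (x i)))"
    by (rule density_PiM) (auto intro: sigma_finite_lborel N.sigma_finite_measure_axioms)
  also have "\<dots> = density (lborel_dim d) (\<lambda>x. ennreal (exp (- (\<Sum>i<d. (x i)\<^sup>2) / 2) / sqrt (2 * pi) ^ d))"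
  proof (rule arg_cong[where f = "density _"], rule ext)
    fix x :: "nat \<Rightarrow> real"
    have "(\<Prod>i<d. std_normal_density (x i)) = exp (- (\<Sum>i<d. (x i)\<^sup>2) / 2) / sqrt (2 * pi) ^ d"
      by (simp add: std_normal_density_def prod_dividef exp_sum[symmetric] sum_negf sum_divide_distrib)
    then show "(\<Prod>i<d. ennreal (std_normal_density (x i))) = ennreal (exp (- (\<Sum>i<d. (x i)\<^sup>2) / 2) / sqrt (2 * pi) ^ d)"
      by (simp add: prod_ennreal)
  qed
  finally show ?thesis .
qed

lemma sets_std_normal_PiM [measurable_cong, simp]: "sets (std_normal_PiM {..<d}) = sets (lborel_dim d)"
  by (intro sets_PiM_cong) auto

text \<open>The pushforward of Lebesgue measure is a multiple of it by uniqueness of Haar measure; the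
  factor is \<open>1\<close> because the standard Gaussian density is rotation invariant.\<close>

lemma distr_lborel_dim_orthogonal:
  fixes U :: "real mat"
  assumes U: "U \<in> carrier_mat d d" "transpose_mat U * U = 1\<^sub>m d"
  shows "distr (lborel_dim d) (lborel_dim d) (affine_map d (0\<^sub>v d) U) = lborel_dim d"
proof -
  let ?L = "lborel_dim d" and ?T = "affine_map d (0\<^sub>v d) U" and ?T' = "affine_map d (0\<^sub>v d) (transpose_mat U)"
  let ?g = "\<lambda>x. ennreal (exp (- (\<Sum>i<d. (x i)\<^sup>2) / 2) / sqrt (2 * pi) ^ d)"
  have Ut: "transpose_mat U \<in> carrier_mat d d" "U * transpose_mat U = 1\<^sub>m d"
    using U mat_mult_left_right_inverse[of "transpose_mat U" d U] by auto
  have [measurable]: "?T \<in> measurable ?L ?L" "?T' \<in> measurable ?L ?L" using U Ut by auto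
  define \<nu> where "\<nu> = distr ?L ?L ?T"
  have sets[measurable_cong, simp]: "sets \<nu> = sets ?L" by (simp add: \<nu>_def)
  have T'T: "?T' (?T x) = x" if "x \<in> space ?L" for x
    using U Ut that by (simp add: affine_map_comp affine_map_id mult_mat_zero_vec[of _ d])
  have TT': "?T (?T' x) = x" if "x \<in> space ?L" for x
    using U Ut that by (simp add: affine_map_comp affine_map_id mult_mat_zero_vec[of _ d])
  \<comment> \<open>A measure is sigma-finite if some image of it is, and undoing the rotation turns
    \<nu> back into Lebesgue measure.\<close>
  have "distr \<nu> ?L ?T' = distr ?L ?L (\<lambda>x. x)"
    unfolding \<nu>_def by (subst distr_distr) (auto simp: T'T cong: distr_cong)
  then have "distr \<nu> ?L ?T' = ?L" by simp
  then have sf: "sigma_finite_measure \<nu>"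
    using sigma_finite_measure_distr[of \<nu> ?L ?T'] sigma_finite_lborel_dim by simp
  have inv: "distr \<nu> ?L (translate d v) = \<nu>" if v: "v \<in> space ?L" for v
  proof -
    \<comment> \<open>Shifting by \<open>v\<close> after the rotation is the same as shifting by the
      rotated-back \<open>v\<close> before it; so \<nu> inherits translation invariance.\<close>
    have e: "translate d v (?T x) = ?T (translate d (?T' v) x)" for x
    proof -
      have sh: "translate d u y = affine_map d (Matrix.vec d u) (1\<^sub>m d) y" for u y
        by (auto simp: translate_def affine_map_def)
      have "Matrix.vec d v = U *\<^sub>v (transpose_mat U *\<^sub>v Matrix.vec d v)"
        using U Ut by (subst assoc_mult_mat_vec[symmetric, of _ d d _ d]) auto
      then show ?thesis
        unfolding sh using U Ut by (simp add: affine_map_comp vec_affine_map)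
    qed
    have "distr \<nu> ?L (translate d v) = distr ?L ?L (\<lambda>x. ?T (translate d (?T' v) x))"
      unfolding \<nu>_def by (subst distr_distr) (auto simp: comp_def e)
    also have "\<dots> = distr (distr ?L ?L (translate d (?T' v))) ?L ?T"
      by (subst distr_distr) (auto simp: comp_def)
    also have "\<dots> = \<nu>" by (simp add: distr_lborel_dim_translate \<nu>_def)
    finally show ?thesis .
  qed
  \<comment> \<open>The unit cube has Lebesgue measure 1, so the uniqueness identity makes \<nu> the
    multiple of Lebesgue measure with factor \<open>emeasure \<nu> B\<close>.\<close>
  define B where "B = Pi\<^sub>E {..<d} (\<lambda>_. {0..1::real})"
  have B: "B \<in> sets ?L" unfolding B_def by (intro sets_PiM_I_finite) auto
  interpret product_sigma_finite "\<lambda>_::nat. lborel :: real measure" by standard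
  have LB: "emeasure ?L B = 1" unfolding B_def by (subst emeasure_PiM) auto
  define c where "c = emeasure \<nu> B"
  have \<nu>: "\<nu> = scale_measure c ?L"
  proof (rule measure_eqI)
    fix A assume "A \<in> sets \<nu>"
    then show "emeasure \<nu> A = emeasure (scale_measure c ?L) A"
      using translation_invariant_unique[OF sf sets inv _ B, of A] by (simp add: LB c_def)
  qed simp
  have g1: "(\<integral>\<^sup>+x. ?g x \<partial>?L) = 1"
  proof -
    interpret N: prob_space "std_normal_PiM {..<d}"
      using real_dist_normal_dist by (intro prob_space_PiM) (simp add: real_distribution_def)
    show ?thesis using N.emeasure_space_1
      unfolding std_normal_PiM_eq_density by (subst (asm) emeasure_density) (auto cong: nn_integral_cong)
  qed
  have "(\<integral>\<^sup>+x. ?g x \<partial>?L) = (\<integral>\<^sup>+x. ?g (?T x) \<partial>?L)"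
    using sum_squares_orthogonal[OF U] by simp
  also have "\<dots> = (\<integral>\<^sup>+x. ?g x \<partial>\<nu>)"
    unfolding \<nu>_def by (rule nn_integral_distr[symmetric]) measurable
  also have "\<dots> = c * (\<integral>\<^sup>+x. ?g x \<partial>?L)"
    unfolding \<nu> by (rule nn_integral_scale_measure) measurable
  finally have "c = 1" unfolding g1 by simp
  then show ?thesis using \<nu> by (simp add: \<nu>_def)
qed

lemma distr_std_normal_orthogonal:
  fixes U :: "real mat"
  assumes U: "U \<in> carrier_mat d d" "transpose_mat U * U = 1\<^sub>m d"
  shows "distr (std_normal_PiM {..<d}) (lborel_dim d) (affine_map d (0\<^sub>v d) U) = std_normal_PiM {..<d}"
proof -
  let ?g = "\<lambda>x. ennreal (exp (- (\<Sum>i<d. (x i)\<^sup>2) / 2) / sqrt (2 * pi) ^ d)"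
  have "std_normal_PiM {..<d} = density (lborel_dim d) (\<lambda>x. ?g (affine_map d (0\<^sub>v d) U x))"
    unfolding std_normal_PiM_eq_density sum_squares_orthogonal[OF U] ..
  then have "distr (std_normal_PiM {..<d}) (lborel_dim d) (affine_map d (0\<^sub>v d) U) =
    distr (density (lborel_dim d) (\<lambda>x. ?g (affine_map d (0\<^sub>v d) U x))) (lborel_dim d) (affine_map d (0\<^sub>v d) U)"
    by simp
  also have "\<dots> = density (distr (lborel_dim d) (lborel_dim d) (affine_map d (0\<^sub>v d) U)) ?g"
    using U by (intro distr_density_comp) measurable
  finally show ?thesis
    by (simp add: distr_lborel_dim_orthogonal[OF U] std_normal_PiM_eq_density)
qed

section \<open>Reduction of two Gaussians to a separable quadratic\<close>

text \<open>Full rank gives a nonzero determinant, hence an inverse; only then does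
  \<open>the\<close> select an actual inverse matrix.\<close>

lemma full_rank_covarianceD:
  assumes "full_rank_covariance d \<Sigma>"
  shows "\<Sigma> \<in> carrier_mat d d" "transpose_mat \<Sigma> = \<Sigma>" "Determinant.det \<Sigma> \<noteq> 0"
    "v \<in> carrier_vec d \<Longrightarrow> 0 \<le> v \<bullet> (\<Sigma> *\<^sub>v v)"
    "the (mat_inverse \<Sigma>) \<in> carrier_mat d d" "the (mat_inverse \<Sigma>) * \<Sigma> = 1\<^sub>m d"
proof -
  show S: "\<Sigma> \<in> carrier_mat d d" "transpose_mat \<Sigma> = \<Sigma>"
    and "v \<in> carrier_vec d \<Longrightarrow> 0 \<le> v \<bullet> (\<Sigma> *\<^sub>v v)"
    using assms by (auto simp: full_rank_covariance_def)
  show det: "Determinant.det \<Sigma> \<noteq> 0"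
    using vec_space.det_rank_iff[OF S(1)] assms by (simp add: full_rank_covariance_def)
  have "mat_inverse \<Sigma> \<noteq> None"
    using mat_inverse(1)[OF S(1), where b = "()"] det_non_zero_imp_unit[OF S(1) det, where b = "()"] by blast
  then obtain B where "mat_inverse \<Sigma> = Some B" by auto
  then show "the (mat_inverse \<Sigma>) \<in> carrier_mat d d" "the (mat_inverse \<Sigma>) * \<Sigma> = 1\<^sub>m d"
    using mat_inverse(2)[OF S(1)] by auto
qed

lemma distr_lborel_dim_diag:
  assumes c: "\<And>i. i < d \<Longrightarrow> 0 < c i"
  shows "distr (lborel_dim d) (lborel_dim d) (\<lambda>x. \<lambda>i\<in>{..<d}. c i * x i) =
    density (lborel_dim d) (\<lambda>_. ennreal (1 / (\<Prod>i<d. c i)))"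
proof -
  define k where "k i = (if i < d then ennreal (inverse (c i)) else 1)" for i
  have N: "sigma_finite_measure (density lborel (\<lambda>_::real. k i))" for i
    by (intro sigma_finite_measure.sigma_finite_iff_density_finite[THEN iffD2])
       (auto simp: k_def intro: sigma_finite_lborel)
  have "distr (lborel_dim d) (lborel_dim d) (\<lambda>x. \<lambda>i\<in>{..<d}. c i * x i) =
    distr (lborel_dim d) (Pi\<^sub>M {..<d} (\<lambda>i. density lborel (\<lambda>_. k i))) (\<lambda>x. \<lambda>i\<in>{..<d}. c i * x i)"
    by (intro distr_cong refl) (auto intro!: sets_PiM_cong)
  also have "\<dots> = Pi\<^sub>M {..<d} (\<lambda>i. density lborel (\<lambda>_. k i))"
  proof (rule distr_PiM_componentwise)
    fix i assume i: "i \<in> {..<d}"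
    then have "c i > 0" using c by auto
    have "distr lborel (density lborel (\<lambda>_. k i)) (\<lambda>x. c i * x) = distr lborel borel ((*) (c i))"
      by (intro distr_cong) auto
    also have "\<dots> = density lborel (\<lambda>_. k i)"
      using \<open>c i > 0\<close> i by (subst lborel_distr_mult) (auto simp: k_def)
    finally show "distr lborel (density lborel (\<lambda>_. k i)) (\<lambda>x. c i * x) = density lborel (\<lambda>_. k i)" .
  qed (auto intro: N sigma_finite_lborel)
  also have "\<dots> = density (lborel_dim d) (\<lambda>_. \<Prod>i<d. k i)"
    by (rule density_PiM) (auto intro: N sigma_finite_lborel)
  also have "(\<Prod>i<d. k i) = (\<Prod>i<d. ennreal (inverse (c i)))"
    by (intro prod.cong) (auto simp: k_def)
  also have "\<dots> = ennreal (1 / (\<Prod>i<d. c i))"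
    using c by (subst prod_ennreal) (auto simp: prod_dividef inverse_eq_divide less_imp_le)
  finally show ?thesis .
qed

text \<open>The quadratic form is rewritten as a sum of products of coordinates of two affine maps,
  whose measurability is known.\<close>

lemma borel_measurable_gaussian_density [measurable]:
  assumes \<mu>: "\<mu> \<in> carrier_vec d" and B: "the (mat_inverse \<Sigma>) \<in> carrier_mat d d"
  shows "gaussian_density d \<mu> \<Sigma> \<in> borel_measurable (lborel_dim d)"
proof -
  let ?B = "the (mat_inverse \<Sigma>)"
  let ?z = "affine_map d (- \<mu>) (1\<^sub>m d)" and ?w = "affine_map d (?B *\<^sub>v (- \<mu>)) ?B"
  have eq: "gaussian_density d \<mu> \<Sigma> x = exp (- (\<Sum>i\<in>{..<d}. ?z x i * ?w x i) / 2)
      / sqrt ((2 * pi) ^ d * Determinant.det \<Sigma>)" for x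
  proof -
    have z: "Matrix.vec d x - \<mu> = - \<mu> + 1\<^sub>m d *\<^sub>v Matrix.vec d x"
      using \<mu> by (intro eq_vecI) auto
    have w: "?B *\<^sub>v (Matrix.vec d x - \<mu>) = ?B *\<^sub>v (- \<mu>) + ?B *\<^sub>v Matrix.vec d x"
      unfolding z using \<mu> B by (subst mult_add_distrib_mat_vec[of _ d d]) auto
    have "(Matrix.vec d x - \<mu>) \<bullet> (?B *\<^sub>v (Matrix.vec d x - \<mu>)) = (\<Sum>i\<in>{..<d}. ?z x i * ?w x i)"
      unfolding w unfolding z using \<mu> B
      by (auto simp: scalar_prod_def[of _ "_ + _"] affine_map_def lessThan_atLeast0 intro!: sum.cong)
    then show ?thesis by (simp add: gaussian_density_def Let_def)
  qed
  have zw: "?z \<in> measurable (lborel_dim d) (lborel_dim d)" "?w \<in> measurable (lborel_dim d) (lborel_dim d)"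
    using B by auto
  have "(\<lambda>x. ?z x i * ?w x i) \<in> borel_measurable (lborel_dim d)" if "i \<in> {..<d}" for i
    using measurable_compose[OF zw(1) measurable_component_singleton[OF that]]
      measurable_compose[OF zw(2) measurable_component_singleton[OF that]]
    by (intro borel_measurable_times) auto
  then have "(\<lambda>x. \<Sum>i\<in>{..<d}. ?z x i * ?w x i) \<in> borel_measurable (lborel_dim d)"
    by (rule borel_measurable_sum)
  then show ?thesis unfolding eq by measurable
qed

text \<open>One-sided inverses of square matrices are two-sided. It turns the quadratic form of the
  inverse covariance into the plain squared norm of \<open>y\<close> at the point
  \<open>W y\<close>.\<close>

lemma inverse_covariance_factor:
  fixes W :: "real mat"
  assumes cov: "full_rank_covariance d \<Sigma>" and W: "W \<in> carrier_mat d d" "W * transpose_mat W = \<Sigma>"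
  shows "transpose_mat W * (the (mat_inverse \<Sigma>) * W) = 1\<^sub>m d"
proof -
  note D = full_rank_covarianceD[OF cov]
  have "(the (mat_inverse \<Sigma>) * W) * transpose_mat W = 1\<^sub>m d"
    using D(5,6) W by (subst assoc_mult_mat[of _ d d _ d _ d]) auto
  then show ?thesis using mat_mult_left_right_inverse[of "the (mat_inverse \<Sigma>) * W" d] D(5) W by auto
qed

lemma scalar_prod_mult_mat_vec:
  fixes A :: "real mat"
  assumes "A \<in> carrier_mat n d" "x \<in> carrier_vec d" "y \<in> carrier_vec n"
  shows "(A *\<^sub>v x) \<bullet> y = x \<bullet> (transpose_mat A *\<^sub>v y)"
proof -
  have "(A *\<^sub>v x) \<bullet> y = y \<bullet> (A *\<^sub>v x)" using assms by (intro comm_scalar_prod[of _ n]) auto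
  also have "\<dots> = (transpose_mat A *\<^sub>v y) \<bullet> x" using transpose_vec_mult_scalar[OF assms] by simp
  also have "\<dots> = x \<bullet> (transpose_mat A *\<^sub>v y)" using assms by (intro comm_scalar_prod[of _ d]) auto
  finally show ?thesis .
qed

lemma gaussian_density_affine_map:
  assumes cov: "full_rank_covariance d \<Sigma>" and \<mu>: "\<mu> \<in> carrier_vec d"
    and W: "W \<in> carrier_mat d d" "W * transpose_mat W = \<Sigma>"
  shows "gaussian_density d \<mu> \<Sigma> (affine_map d \<mu> W y) =
    exp (- (\<Sum>i<d. (y i)\<^sup>2) / 2) / sqrt ((2 * pi) ^ d * Determinant.det \<Sigma>)"
proof -
  let ?y = "Matrix.vec d y" and ?B = "the (mat_inverse \<Sigma>)"
  note D = full_rank_covarianceD[OF cov]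
  have e: "Matrix.vec d (affine_map d \<mu> W y) - \<mu> = W *\<^sub>v ?y"
    unfolding vec_affine_map[OF \<mu> W(1)] using \<mu> W by (intro eq_vecI) auto
  have "(W *\<^sub>v ?y) \<bullet> (?B *\<^sub>v (W *\<^sub>v ?y)) = ?y \<bullet> (transpose_mat W *\<^sub>v (?B *\<^sub>v (W *\<^sub>v ?y)))"
    using W D(5) by (intro scalar_prod_mult_mat_vec[of _ d d]) auto
  also have "transpose_mat W *\<^sub>v (?B *\<^sub>v (W *\<^sub>v ?y)) = (transpose_mat W * (?B * W)) *\<^sub>v ?y"
    using W D(5) by (simp add: assoc_mult_mat_vec[of _ d d _ d])
  finally show ?thesis
    unfolding gaussian_density_def Let_def e sum_squares_eq_scalar_prod
    by (simp add: inverse_covariance_factor[OF cov W])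
qed

text \<open>Links the density, with its inverse and determinant, to an image of independent standard
  normal variables. \<open>W\<close> is an orthogonal matrix times the roots of the eigenvalues, so
  Lebesgue measure is transported by a scaling, a rotation and a translation, of which only the
  scaling changes volume.\<close>

lemma gaussian_affine:
  assumes cov: "full_rank_covariance d \<Sigma>" and \<mu>: "\<mu> \<in> carrier_vec d"
  obtains W where "W \<in> carrier_mat d d" "W * transpose_mat W = \<Sigma>"
    "gaussian d \<mu> \<Sigma> = distr (std_normal_PiM {..<d}) (lborel_dim d) (affine_map d \<mu> W)"
proof -
  note D = full_rank_covarianceD[OF cov]
  let ?L = "lborel_dim d" and ?p = "gaussian_density d \<mu> \<Sigma>"
  obtain U l where U: "U \<in> carrier_mat d d" "transpose_mat U * U = 1\<^sub>m d"
    and diag: "transpose_mat U * \<Sigma> * U = Matrix.mat d d (\<lambda>(i,j). if i = j then l i else 0)"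
    using real_spectral[OF D(1,2)] by blast
  have Ut: "transpose_mat U \<in> carrier_mat d d" "U * transpose_mat U = 1\<^sub>m d"
    using U mat_mult_left_right_inverse[of "transpose_mat U" d U] by auto
  have det: "Determinant.det \<Sigma> = (\<Prod>i<d. l i)"
  proof -
    have "Determinant.det (transpose_mat U * \<Sigma> * U) = Determinant.det \<Sigma> * (Determinant.det (transpose_mat U) * Determinant.det U)"
      using U Ut D(1) by (simp add: det_mult[of _ d] mult.commute mult.left_commute)
    also have "Determinant.det (transpose_mat U) * Determinant.det U = 1"
      using U Ut det_mult[of "transpose_mat U" d U] by simp
    finally have "Determinant.det \<Sigma> = Determinant.det (Matrix.mat d d (\<lambda>(i,j). if i = j then l i else 0))"
      by (simp add: diag)
    also have "\<dots> = (\<Prod>i<d. l i)"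
      by (subst det_upper_triangular[of _ d])
         (auto simp: prod_list_diag_prod upper_triangular_def lessThan_atLeast0)
    finally show ?thesis .
  qed
  \<comment> \<open>Semidefiniteness is tested on the eigenvector \<open>col U i\<close>; the
    nonzero determinant then excludes the value 0.\<close>
  have l: "0 < l i" if i: "i < d" for i
  proof -
    have "l i = (transpose_mat U * \<Sigma> * U) $$ (i,i)" using i by (simp add: diag)
    also have "transpose_mat U * \<Sigma> * U = transpose_mat U * (\<Sigma> * U)"
      using U Ut D(1) by (intro assoc_mult_mat[of _ d d _ d _ d]) auto
    also have "\<dots> $$ (i,i) = Matrix.row (transpose_mat U) i \<bullet> col (\<Sigma> * U) i"
      using i U D(1) by (intro index_mult_mat(1)) auto
    also have "Matrix.row (transpose_mat U) i = col U i" using i U by simp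
    also have "col (\<Sigma> * U) i = \<Sigma> *\<^sub>v col U i" using D(1) U(1) i by (rule col_mult2)
    finally have "0 \<le> l i" using D(4)[of "col U i"] i U by auto
    moreover have "l i \<noteq> 0" using D(3) i unfolding det by (auto simp: prod_zero_iff)
    ultimately show ?thesis by simp
  qed
  define S where "S = Matrix.mat d d (\<lambda>(i,j). if i = j then sqrt (l i) else 0)"
  define W where "W = U * S"
  have S: "S \<in> carrier_mat d d" by (simp add: S_def)
  have W: "W \<in> carrier_mat d d" using U S by (simp add: W_def)
  have St: "transpose_mat S = S" by (intro eq_matI) (auto simp: S_def)
  have SS: "S * S = transpose_mat U * \<Sigma> * U"
  proof (rule eq_matI)
    fix i j assume "i < dim_row (transpose_mat U * \<Sigma> * U)" "j < dim_col (transpose_mat U * \<Sigma> * U)"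
    then have ij: "i < d" "j < d" using U by auto
    have "(S * S) $$ (i,j) = (\<Sum>k = 0..<d. (if i = k then sqrt (l i) else 0) * (if k = j then sqrt (l k) else 0))"
      using ij by (simp add: S_def scalar_prod_def)
    also have "\<dots> = (\<Sum>k = 0..<d. if k = i then (if i = j then sqrt (l i) * sqrt (l i) else 0) else 0)"
      by (intro sum.cong) auto
    also have "\<dots> = (if i = j then l i else 0)" using ij l[of i] by auto
    finally show "(S * S) $$ (i,j) = (transpose_mat U * \<Sigma> * U) $$ (i,j)" using ij by (simp add: diag)
  qed (use U S in auto)
  have WW: "W * transpose_mat W = \<Sigma>"
  proof -
    have "transpose_mat W = S * transpose_mat U"
      unfolding W_def using U(1) S transpose_mult[of U d d S d] by (simp add: St)
    then have "W * transpose_mat W = U * (S * S) * transpose_mat U"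
      using U(1) Ut(1) S by (simp add: W_def assoc_mult_mat[of _ d d _ d _ d])
    also have "\<dots> = (U * transpose_mat U) * \<Sigma> * (U * transpose_mat U)"
      unfolding SS using U(1) Ut(1) D(1) by (simp add: assoc_mult_mat[of _ d d _ d _ d])
    finally show ?thesis using Ut D(1) by simp
  qed
  have Um[measurable]: "affine_map d (0\<^sub>v d) U \<in> measurable ?L ?L" using U by measurable
  have Sm[measurable]: "(\<lambda>x. \<lambda>i\<in>{..<d}. sqrt (l i) * x i) \<in> measurable ?L ?L"
    by (intro measurable_restrict) measurable
  have Wm[measurable]: "affine_map d \<mu> W \<in> measurable ?L ?L" using W by measurable
  have [measurable]: "?p \<in> borel_measurable ?L"
    using \<mu> D(5) by measurable
  \<comment> \<open>The square root of the determinant of \<Sigma>, which is the volume factor of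
    \<open>W\<close>.\<close>
  define k where "k = (\<Prod>i<d. sqrt (l i))"
  have k: "0 < k" unfolding k_def using l by (auto intro!: prod_pos)
  have push: "distr ?L ?L (affine_map d \<mu> W) = density ?L (\<lambda>_. ennreal (1 / k))"
  proof -
    have e: "affine_map d \<mu> W x = translate d (\<lambda>i. \<mu> $ i) (affine_map d (0\<^sub>v d) U (\<lambda>i\<in>{..<d}. sqrt (l i) * x i))" for x
    proof -
      have "Matrix.vec d (\<lambda>i\<in>{..<d}. sqrt (l i) * x i) = S *\<^sub>v Matrix.vec d x"
        by (intro eq_vecI) (auto simp: S_def scalar_prod_def if_distrib[of "\<lambda>z. z * _"] cong: if_cong)
      then show ?thesis using U S \<mu>
        by (auto simp: affine_map_def translate_def W_def assoc_mult_mat_vec[of _ d d _ d] add.commute)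
    qed
    have "distr ?L ?L (affine_map d \<mu> W) =
      distr (distr (distr ?L ?L (\<lambda>x. \<lambda>i\<in>{..<d}. sqrt (l i) * x i)) ?L (affine_map d (0\<^sub>v d) U)) ?L (translate d (\<lambda>i. \<mu> $ i))"
      unfolding ext[of "affine_map d \<mu> W", OF e] by (simp add: distr_distr comp_def)
    also have "distr ?L ?L (\<lambda>x. \<lambda>i\<in>{..<d}. sqrt (l i) * x i) = density ?L (\<lambda>_. ennreal (1 / k))"
      unfolding k_def using l by (intro distr_lborel_dim_diag) auto
    also have "distr \<dots> ?L (affine_map d (0\<^sub>v d) U) = density ?L (\<lambda>_. ennreal (1 / k))"
      by (subst distr_density_comp[where f = "\<lambda>_. ennreal (1 / k)"]) (simp_all add: distr_lborel_dim_orthogonal[OF U])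
    also have "distr \<dots> ?L (translate d (\<lambda>i. \<mu> $ i)) = density ?L (\<lambda>_. ennreal (1 / k))"
      by (subst distr_density_comp[where f = "\<lambda>_. ennreal (1 / k)"]) (simp_all add: distr_lborel_dim_translate)
    finally show ?thesis .
  qed
  \<comment> \<open>Pulled back along the affine map, the Gaussian density is a multiple of the
    standard one; the factor \<open>k\<close> will cancel the \<open>1 / k\<close> acquired by
    Lebesgue measure.\<close>
  have "std_normal_PiM {..<d} = density ?L (\<lambda>x. ennreal (k * ?p (affine_map d \<mu> W x)))"
  proof -
    have "sqrt ((2 * pi) ^ d * Determinant.det \<Sigma>) = sqrt (2 * pi) ^ d * k"
    proof -
      have "sqrt (\<Prod>i\<in>A. l i) = (\<Prod>i\<in>A. sqrt (l i))" for A
        by (induction A rule: infinite_finite_induct) (simp_all add: real_sqrt_mult)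
      then show ?thesis unfolding det k_def by (simp only: real_sqrt_mult real_sqrt_power)
    qed
    then show ?thesis
      unfolding std_normal_PiM_eq_density gaussian_density_affine_map[OF cov \<mu> W WW] using k by simp
  qed
  then have "distr (std_normal_PiM {..<d}) ?L (affine_map d \<mu> W) =
    density (distr ?L ?L (affine_map d \<mu> W)) (\<lambda>x. ennreal (k * ?p x))"
    by (simp add: distr_density_comp[where f = "\<lambda>x. ennreal (k * ?p x)"])
  also have "\<dots> = density ?L (\<lambda>x. ennreal (1 / k) * ennreal (k * ?p x))"
    unfolding push by (subst density_density_eq) auto
  also have "\<dots> = gaussian d \<mu> \<Sigma>"
    unfolding gaussian_def using k by (simp add: ennreal_mult'[symmetric])
  finally show ?thesis using that[OF W WW] by simp
qed

text \<open>Simultaneous diagonalisation: \<open>W\<close> turns the first covariance into the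
  identity, and an orthogonal \<open>U\<close> diagonalises the second inverse covariance without
  undoing this. In the coordinates \<open>Y\<close> the log density ratio has no mixed
  terms.\<close>

theorem gaussian_pair_separable:
  assumes cov1: "full_rank_covariance d \<Sigma>1" and \<mu>1: "\<mu>1 \<in> carrier_vec d"
    and cov2: "full_rank_covariance d \<Sigma>2" and \<mu>2: "\<mu>2 \<in> carrier_vec d"
  obtains Y k a b where "Y \<in> measurable (gaussian d \<mu>1 \<Sigma>1) (std_normal_PiM {..<d})"
    "distr (gaussian d \<mu>1 \<Sigma>1) (std_normal_PiM {..<d}) Y = std_normal_PiM {..<d}"
    "gaussian d \<mu>2 \<Sigma>2 =
      density (gaussian d \<mu>1 \<Sigma>1) (\<lambda>x. ennreal (exp (separable_quadratic {..<d} k a b (Y x))))"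
proof -
  let ?L = "lborel_dim d" and ?N = "std_normal_PiM {..<d}"
  let ?B1 = "the (mat_inverse \<Sigma>1)" and ?B2 = "the (mat_inverse \<Sigma>2)"
  let ?p1 = "gaussian_density d \<mu>1 \<Sigma>1" and ?p2 = "gaussian_density d \<mu>2 \<Sigma>2"
  note D1 = full_rank_covarianceD[OF cov1] and D2 = full_rank_covarianceD[OF cov2]
  \<comment> \<open>Makes both normalising constants positive, so that the logarithm of their
    quotient can enter \<open>k\<close>.\<close>
  have det: "0 < Determinant.det \<Sigma>" if cov: "full_rank_covariance d \<Sigma>" for \<Sigma>
  proof -
    obtain W where W: "W \<in> carrier_mat d d" "W * transpose_mat W = \<Sigma>"
      using gaussian_affine[OF cov, of "0\<^sub>v d"] by auto
    then have "Determinant.det \<Sigma> = (Determinant.det W)\<^sup>2"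
      using det_mult[of W d "transpose_mat W"] by (simp add: det_transpose power2_eq_square)
    then show ?thesis using full_rank_covarianceD(3)[OF cov] by simp
  qed
  obtain W where W: "W \<in> carrier_mat d d" "W * transpose_mat W = \<Sigma>1"
    and gW: "gaussian d \<mu>1 \<Sigma>1 = distr ?N ?L (affine_map d \<mu>1 W)"
    using gaussian_affine[OF cov1 \<mu>1] by blast
  have B2sym: "transpose_mat ?B2 = ?B2"
  proof -
    have r: "\<Sigma>2 * ?B2 = 1\<^sub>m d" using mat_mult_left_right_inverse[OF D2(5,1,6)] .
    have l: "transpose_mat ?B2 * \<Sigma>2 = 1\<^sub>m d"
      using transpose_mult[OF D2(1,5)] r D2(2) by simp
    have "transpose_mat ?B2 = transpose_mat ?B2 * (\<Sigma>2 * ?B2)" using r D2(5) by simp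
    also have "\<dots> = (transpose_mat ?B2 * \<Sigma>2) * ?B2"
      using D2(1,5) by (intro assoc_mult_mat[symmetric, of _ d d _ d _ d]) auto
    finally show ?thesis using l D2(5) by simp
  qed
  \<comment> \<open>The second inverse covariance in the coordinates where the first Gaussian is
    standard.\<close>
  define K where "K = transpose_mat W * ?B2 * W"
  have K: "K \<in> carrier_mat d d" using W D2(5) by (simp add: K_def)
  have Ksym: "transpose_mat K = K"
  proof -
    have "transpose_mat K = transpose_mat W * transpose_mat (transpose_mat W * ?B2)"
      unfolding K_def using W D2(5) by (intro transpose_mult) auto
    also have "transpose_mat (transpose_mat W * ?B2) = ?B2 * W"
      using transpose_mult[of "transpose_mat W" d d ?B2 d] W D2(5) B2sym by simp
    finally show ?thesis unfolding K_def using W(1) D2(5) by (simp add: assoc_mult_mat[of _ d d _ d _ d])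
  qed
  obtain U l where U: "U \<in> carrier_mat d d" "transpose_mat U * U = 1\<^sub>m d"
    and diag: "transpose_mat U * K * U = Matrix.mat d d (\<lambda>(i,j). if i = j then l i else 0)"
    using real_spectral[OF K Ksym] by blast
  have UU: "U * transpose_mat U = 1\<^sub>m d"
    using U mat_mult_left_right_inverse[of "transpose_mat U" d U] by auto
  define V where "V = W * U"
  have V: "V \<in> carrier_mat d d" using W U by (simp add: V_def)
  have Vt: "transpose_mat V = transpose_mat U * transpose_mat W"
    unfolding V_def using W(1) U(1) by (rule transpose_mult)
  have VV: "V * transpose_mat V = \<Sigma>1"
  proof -
    have "V * transpose_mat V = W * (U * transpose_mat U) * transpose_mat W"
      unfolding Vt unfolding V_def using W(1) U(1) by (simp add: assoc_mult_mat[of _ d d _ d _ d])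
    then show ?thesis using W UU by simp
  qed
  have VBV: "transpose_mat V * (?B2 * V) = Matrix.mat d d (\<lambda>(i,j). if i = j then l i else 0)"
    unfolding diag[symmetric] Vt unfolding V_def K_def using W(1) U(1) D2(5)
    by (simp add: assoc_mult_mat[of _ d d _ d _ d])
  \<comment> \<open>The inverse of \<open>V\<close>, because \<open>V * transpose_mat V\<close> is
    the first covariance.\<close>
  define V' where "V' = transpose_mat V * ?B1"
  have V': "V' \<in> carrier_mat d d" using V D1(5) by (simp add: V'_def)
  have V'V: "V' * V = 1\<^sub>m d"
    using inverse_covariance_factor[OF cov1 V VV] V D1(5)
    by (simp add: V'_def assoc_mult_mat[of _ d d _ d _ d])
  have VV': "V * V' = 1\<^sub>m d" using mat_mult_left_right_inverse[OF V' V V'V] .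
  let ?G = "affine_map d \<mu>1 V"
  define Y where "Y = affine_map d (V' *\<^sub>v (- \<mu>1)) V'"
  have V'\<mu>: "V' *\<^sub>v (- \<mu>1) \<in> carrier_vec d" using V' \<mu>1 by auto
  have YG: "Y (?G y) = y" if "y \<in> space ?L" for y
  proof -
    have "V' *\<^sub>v (- \<mu>1) + V' *\<^sub>v \<mu>1 = V' *\<^sub>v (- \<mu>1 + \<mu>1)"
      using V' \<mu>1 by (intro mult_add_distrib_mat_vec[symmetric]) auto
    then have "V' *\<^sub>v (- \<mu>1) + V' *\<^sub>v \<mu>1 = 0\<^sub>v d"
      using V' \<mu>1 by (simp add: mult_mat_zero_vec[of _ d d])
    then show ?thesis
      unfolding Y_def affine_map_comp[OF V'\<mu> V' \<mu>1 V] V'V using that by (simp add: affine_map_id)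
  qed
  have GY: "?G (Y x) = x" if "x \<in> space ?L" for x
  proof -
    have "\<mu>1 + V *\<^sub>v (V' *\<^sub>v (- \<mu>1)) = \<mu>1 + (V * V') *\<^sub>v (- \<mu>1)"
      using V V' \<mu>1 by (simp add: assoc_mult_mat_vec[of _ d d _ d])
    then have "\<mu>1 + V *\<^sub>v (V' *\<^sub>v (- \<mu>1)) = 0\<^sub>v d" using \<mu>1 by (auto simp: VV')
    then show ?thesis
      unfolding Y_def affine_map_comp[OF \<mu>1 V V'\<mu> V'] VV' using that by (simp add: affine_map_id)
  qed
  have [measurable]: "?G \<in> measurable ?L ?L" "Y \<in> measurable ?L ?L" "affine_map d \<mu>1 W \<in> measurable ?L ?L"
      "affine_map d (0\<^sub>v d) U \<in> measurable ?L ?L"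
    unfolding Y_def using V V' W U by auto
  have [measurable]: "?p1 \<in> borel_measurable ?L" "?p2 \<in> borel_measurable ?L"
    using \<mu>1 \<mu>2 D1(5) D2(5) by auto
  have sN: "space ?N = space ?L" by (rule sets_eq_imp_space_eq) simp
  \<comment> \<open>Standard normal variables are rotation invariant, so \<open>V = W * U\<close>
    represents the first Gaussian as well as \<open>W\<close> does.\<close>
  have gV: "gaussian d \<mu>1 \<Sigma>1 = distr ?N ?L ?G"
  proof -
    have "gaussian d \<mu>1 \<Sigma>1 = distr (distr ?N ?L (affine_map d (0\<^sub>v d) U)) ?L (affine_map d \<mu>1 W)"
      unfolding gW distr_std_normal_orthogonal[OF U] ..
    also have "\<dots> = distr ?N ?L ?G"
      using W U \<mu>1 by (subst distr_distr)
        (auto simp: comp_def affine_map_comp V_def mult_mat_zero_vec[of _ d d])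
    finally show ?thesis .
  qed
  have Ym: "Y \<in> measurable (gaussian d \<mu>1 \<Sigma>1) ?N" unfolding gV by measurable
  have dY: "distr (gaussian d \<mu>1 \<Sigma>1) ?N Y = ?N"
  proof -
    have "distr (gaussian d \<mu>1 \<Sigma>1) ?N Y = distr ?N ?N (\<lambda>y. Y (?G y))"
      unfolding gV by (subst distr_distr) (auto simp: comp_def)
    also have "\<dots> = distr ?N ?N (\<lambda>y. y)"
      by (intro distr_cong) (auto simp: sN YG)
    finally show ?thesis by simp
  qed
  define c1 where "c1 = sqrt ((2 * pi) ^ d * Determinant.det \<Sigma>1)"
  define c2 where "c2 = sqrt ((2 * pi) ^ d * Determinant.det \<Sigma>2)"
  have c: "0 < c1" "0 < c2" unfolding c1_def c2_def using det[OF cov1] det[OF cov2] by auto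
  define \<delta> where "\<delta> = \<mu>1 - \<mu>2"
  define \<beta> where "\<beta> = ?B2 *\<^sub>v \<delta>"
  have \<delta>: "\<delta> \<in> carrier_vec d" and \<beta>: "\<beta> \<in> carrier_vec d" using \<mu>1 \<mu>2 D2(5) by (auto simp: \<delta>_def \<beta>_def)
  define w where "w = transpose_mat V *\<^sub>v \<beta>"
  have w: "w \<in> carrier_vec d" using V \<beta> by (simp add: w_def)
  \<comment> \<open>The log ratio is the logarithm of \<open>c1 / c2\<close> plus half the squared
    norm of \<open>y\<close> minus half the second quadratic form at \<open>V y + \<delta>\<close>.
    Its square terms give \<open>a\<close>; its cross term appears twice, which cancels the one half
    and gives \<open>b\<close>.\<close>
  define k where "k = ln (c1 / c2) - \<delta> \<bullet> \<beta> / 2"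
  define a where "a i = (1 - l i) / 2" for i
  define b where "b i = - w $ i" for i
  have ratio: "?p2 (?G y) = ?p1 (?G y) * exp (separable_quadratic {..<d} k a b y)" for y
  proof -
    let ?y = "Matrix.vec d y"
    have Vy: "V *\<^sub>v ?y \<in> carrier_vec d" and BVy: "?B2 *\<^sub>v (V *\<^sub>v ?y) \<in> carrier_vec d"
      using V D2(5) by auto
    have e: "Matrix.vec d (?G y) - \<mu>2 = V *\<^sub>v ?y + \<delta>"
      unfolding vec_affine_map[OF \<mu>1 V] \<delta>_def using \<mu>1 \<mu>2 V by (intro eq_vecI) auto
    have q1: "(V *\<^sub>v ?y) \<bullet> (?B2 *\<^sub>v (V *\<^sub>v ?y)) = (\<Sum>i<d. l i * (y i)\<^sup>2)"
    proof -
      have "(V *\<^sub>v ?y) \<bullet> (?B2 *\<^sub>v (V *\<^sub>v ?y)) = ?y \<bullet> (transpose_mat V *\<^sub>v (?B2 *\<^sub>v (V *\<^sub>v ?y)))"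
        using V BVy by (intro scalar_prod_mult_mat_vec[of _ d d]) auto
      also have "transpose_mat V *\<^sub>v (?B2 *\<^sub>v (V *\<^sub>v ?y)) = (transpose_mat V * (?B2 * V)) *\<^sub>v ?y"
        using V D2(5) by (simp add: assoc_mult_mat_vec[of _ d d _ d])
      also have "\<dots> = Matrix.vec d (\<lambda>i. l i * y i)"
        unfolding VBV by (intro eq_vecI) (auto simp: scalar_prod_def if_distrib[of "\<lambda>z. z * _"] cong: if_cong)
      finally show ?thesis
        by (simp add: scalar_prod_def lessThan_atLeast0 power2_eq_square mult_ac)
    qed
    have q2: "(V *\<^sub>v ?y) \<bullet> \<beta> = (\<Sum>i<d. w $ i * y i)"
      unfolding scalar_prod_mult_mat_vec[OF V vec_carrier \<beta>] w_def[symmetric] using w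
      by (simp add: scalar_prod_def lessThan_atLeast0 mult.commute)
    have q3: "\<delta> \<bullet> (?B2 *\<^sub>v (V *\<^sub>v ?y)) = (\<Sum>i<d. w $ i * y i)"
    proof -
      have "\<delta> \<bullet> (?B2 *\<^sub>v (V *\<^sub>v ?y)) = \<beta> \<bullet> (V *\<^sub>v ?y)"
        using transpose_vec_mult_scalar[OF D2(5) Vy \<delta>] by (simp add: B2sym \<beta>_def)
      also have "\<dots> = (V *\<^sub>v ?y) \<bullet> \<beta>" using Vy \<beta> by (intro comm_scalar_prod[of _ d]) auto
      finally show ?thesis by (simp add: q2)
    qed
    have "(V *\<^sub>v ?y + \<delta>) \<bullet> (?B2 *\<^sub>v (V *\<^sub>v ?y + \<delta>)) =
      (V *\<^sub>v ?y + \<delta>) \<bullet> (?B2 *\<^sub>v (V *\<^sub>v ?y) + \<beta>)"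
      unfolding \<beta>_def using Vy \<delta> D2(5) by (subst mult_add_distrib_mat_vec[of _ d d]) auto
    also have "\<dots> = (\<Sum>i<d. l i * (y i)\<^sup>2) + 2 * (\<Sum>i<d. w $ i * y i) + \<delta> \<bullet> \<beta>"
      using Vy BVy \<delta> \<beta>
      by (simp add: add_scalar_prod_distrib[of _ d] scalar_prod_add_distrib[of _ d] q1 q2 q3)
    finally have p2: "?p2 (?G y) = exp (- ((\<Sum>i<d. l i * (y i)\<^sup>2) + 2 * (\<Sum>i<d. w $ i * y i) + \<delta> \<bullet> \<beta>) / 2) / c2"
      unfolding gaussian_density_def Let_def e c2_def by (simp only:)
    have p1: "?p1 (?G y) = exp (- (\<Sum>i<d. (y i)\<^sup>2) / 2) / c1"
      unfolding gaussian_density_affine_map[OF cov1 \<mu>1 V VV] c1_def ..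
    have sq: "separable_quadratic {..<d} k a b y = ln (c1 / c2) +
      ((\<Sum>i<d. (y i)\<^sup>2) / 2 - ((\<Sum>i<d. l i * (y i)\<^sup>2) + 2 * (\<Sum>i<d. w $ i * y i) + \<delta> \<bullet> \<beta>) / 2)"
    proof -
      have "(\<Sum>i<d. a i * (y i)\<^sup>2 + b i * y i) =
        (\<Sum>i<d. (y i)\<^sup>2 / 2 - l i * (y i)\<^sup>2 / 2 - w $ i * y i)"
        by (intro sum.cong) (auto simp: a_def b_def field_simps)
      then show ?thesis
        by (simp add: separable_quadratic_def k_def sum_subtractf sum_divide_distrib[symmetric] add_divide_distrib)
    qed
    have "exp (- B / 2) / c2 = exp (- A / 2) / c1 * exp (ln (c1 / c2) + (A / 2 - B / 2))" for A B
    proof -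
      have "exp (- A / 2) * exp (A / 2 - B / 2) = exp (- B / 2)" by (simp flip: exp_add)
      then show ?thesis using c by (simp add: exp_add)
    qed
    then show ?thesis unfolding p1 p2 sq .
  qed
  have "gaussian d \<mu>2 \<Sigma>2 =
    density (gaussian d \<mu>1 \<Sigma>1) (\<lambda>x. ennreal (exp (separable_quadratic {..<d} k a b (Y x))))"
  proof -
    have [measurable]: "separable_quadratic {..<d} k a b \<in> borel_measurable ?N" by measurable
    then have [measurable]: "separable_quadratic {..<d} k a b \<in> borel_measurable ?L"
      by (simp cong: measurable_cong_sets)
    have "density (gaussian d \<mu>1 \<Sigma>1) (\<lambda>x. ennreal (exp (separable_quadratic {..<d} k a b (Y x)))) =
      density ?L (\<lambda>x. ennreal (?p1 x) * ennreal (exp (separable_quadratic {..<d} k a b (Y x))))"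
      unfolding gaussian_def by (rule density_density_eq) measurable
    also have "\<dots> = density ?L (\<lambda>x. ennreal (?p2 x))"
    proof (rule density_cong)
      show "AE x in ?L. ennreal (?p1 x) * ennreal (exp (separable_quadratic {..<d} k a b (Y x))) = ennreal (?p2 x)"
      proof (rule AE_I2)
        fix x assume x: "x \<in> space ?L"
        show "ennreal (?p1 x) * ennreal (exp (separable_quadratic {..<d} k a b (Y x))) = ennreal (?p2 x)"
          using ratio[of "Y x"] unfolding GY[OF x] by (simp add: ennreal_mult'')
      qed
    qed measurable
    finally show ?thesis unfolding gaussian_def ..
  qed
  then show ?thesis by (rule that[OF Ym dY])
qed

text \<open>The total mass comes from the representation as an image of a product of probability
  measures, not from integrating the density.\<close>

lemma prob_space_gaussian:
  assumes "full_rank_covariance d \<Sigma>" "\<mu> \<in> carrier_vec d"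
  shows "prob_space (gaussian d \<mu> \<Sigma>)"
proof -
  obtain W where W: "W \<in> carrier_mat d d"
    "gaussian d \<mu> \<Sigma> = distr (std_normal_PiM {..<d}) (lborel_dim d) (affine_map d \<mu> W)"
    using gaussian_affine[OF assms] by blast
  have "affine_map d \<mu> W \<in> measurable (lborel_dim d) (lborel_dim d)" using W by measurable
  then have "affine_map d \<mu> W \<in> measurable (std_normal_PiM {..<d}) (lborel_dim d)"
    by (simp cong: measurable_cong_sets)
  then show ?thesis unfolding W(2) by (rule prob_space.prob_space_distr[OF prob_space_std_normal_PiM])
qed

theorem lemma3:
  shows "\<exists>C :: real \<Rightarrow> real.
    (\<forall>\<alpha>\<in>{0<..1}. 0 < C \<alpha> \<and> C \<alpha> < \<alpha> / 8) \<and>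
    C \<in> \<Omega>[at_right 0](\<lambda>\<alpha>. \<alpha> ^ 3) \<and>
    (\<forall>\<alpha>\<in>{0<..1}. \<forall>d :: nat.
      \<forall>\<mu>\<^sub>1\<in>carrier_vec d. \<forall>\<mu>\<^sub>2\<in>carrier_vec d. \<forall>\<Sigma>\<^sub>1 \<Sigma>\<^sub>2.
      \<forall>S\<^sub>1\<in>sets (lborel_dim d). \<forall>S\<^sub>2\<in>sets (lborel_dim d).
        full_rank_covariance d \<Sigma>\<^sub>1 \<longrightarrow>
        full_rank_covariance d \<Sigma>\<^sub>2 \<longrightarrow>
        \<alpha> \<le> measure (gaussian d \<mu>\<^sub>1 \<Sigma>\<^sub>1) S\<^sub>1 \<longrightarrow>
        \<alpha> \<le> measure (gaussian d \<mu>\<^sub>2 \<Sigma>\<^sub>2) S\<^sub>2 \<longrightarrow>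
        tv_dist (truncated_gaussian d \<mu>\<^sub>1 \<Sigma>\<^sub>1 S\<^sub>1) (truncated_gaussian d \<mu>\<^sub>2 \<Sigma>\<^sub>2 S\<^sub>2)
          \<ge> C \<alpha> * tv_dist (gaussian d \<mu>\<^sub>1 \<Sigma>\<^sub>1) (gaussian d \<mu>\<^sub>2 \<Sigma>\<^sub>2))"
\<comment> \<open>On (0, 1] the square of \<alpha> is at most \<alpha>, which gives the strict upper
  bound; near 0 the square dominates the cube, so the required growth holds with room to
  spare.\<close>
proof (intro exI[of _ "\<lambda>\<alpha>. \<alpha>\<^sup>2 / 17280"] conjI ballI allI impI)
  fix \<alpha> :: real assume \<alpha>: "\<alpha> \<in> {0<..1}"
  then show "0 < \<alpha>\<^sup>2 / 17280" by simp
  have "\<alpha> * \<alpha> \<le> \<alpha> * 1" using \<alpha> by (intro mult_left_mono) auto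
  then show "\<alpha>\<^sup>2 / 17280 < \<alpha> / 8" using \<alpha> by (simp add: power2_eq_square)
  fix d \<mu>1 \<mu>2 \<Sigma>1 \<Sigma>2 S1 S2
  assume \<mu>: "\<mu>1 \<in> carrier_vec d" "\<mu>2 \<in> carrier_vec d"
    and S: "S1 \<in> sets (lborel_dim d)" "S2 \<in> sets (lborel_dim d)"
    and cov: "full_rank_covariance d \<Sigma>1" "full_rank_covariance d \<Sigma>2"
    and mass: "\<alpha> \<le> measure (gaussian d \<mu>1 \<Sigma>1) S1" "\<alpha> \<le> measure (gaussian d \<mu>2 \<Sigma>2) S2"
  obtain Y k a b where Y: "Y \<in> measurable (gaussian d \<mu>1 \<Sigma>1) (std_normal_PiM {..<d})"
    "distr (gaussian d \<mu>1 \<Sigma>1) (std_normal_PiM {..<d}) Y = std_normal_PiM {..<d}"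
    "gaussian d \<mu>2 \<Sigma>2 =
      density (gaussian d \<mu>1 \<Sigma>1) (\<lambda>x. ennreal (exp (separable_quadratic {..<d} k a b (Y x))))"
    using gaussian_pair_separable[OF cov(1) \<mu>(1) cov(2) \<mu>(2)] by blast
  have "S1 \<in> sets (gaussian d \<mu>1 \<Sigma>1)" "S2 \<in> sets (gaussian d \<mu>1 \<Sigma>1)"
    using S by (simp_all add: gaussian_def)
  then show "\<alpha>\<^sup>2 / 17280 * tv_dist (gaussian d \<mu>1 \<Sigma>1) (gaussian d \<mu>2 \<Sigma>2)
    \<le> tv_dist (truncated_gaussian d \<mu>1 \<Sigma>1 S1) (truncated_gaussian d \<mu>2 \<Sigma>2 S2)"
    unfolding truncated_gaussian_def using \<alpha> mass
    by (intro tv_dist_conditioned_exp_quadratic_ge[OF _ _ _ Y] prob_space_gaussian cov \<mu>) auto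
next
  show "(\<lambda>\<alpha>. \<alpha>\<^sup>2 / 17280) \<in> \<Omega>[at_right 0](\<lambda>\<alpha>::real. \<alpha> ^ 3)"
    by real_asymp
qed

end
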